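(* Let $n\ge1$, let $\rho=\{r_1,\ldots,r_n\}$ with $0<r_1<\cdots<r_n<\infty$, and let $\alpha,\nu_1,\ldots,\nu_n$ be arbitrary real values. Let $\sigma^A\in\mathcal{S}_0(\rho)$ be the unique Beppo Levi $L_0$-spline with $\sigma^A(r_j)=\nu_j$ for $1\le j\le n$ and $\sigma^A(0)=\alpha$, and let $\sigma^B\in\mathcal{S}_0(\rho)$ be the unique non-singular Beppo Levi $L_0$-spline with $\sigma^B(r_j)=\nu_j$ for $1\le j\le n$. Then: (1) if $f\in\Lambda_0$ satisfies $f(r_j)=\nu_j$ for $1\le j\le n$ and $f(0)=\alpha$, and $f\ne\sigma^A$, then $\|\sigma^A\|_0<\|f\|_0$; (2) if $f\in\Lambda_0$ satisfies $f(r_j)=\nu_j$ for $1\le j\le n$, and $f\neq\sigma^B$, then $\|\sigma^B\|_0<\|f\|_0$.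
   Context: $\Lambda_0$ is the space of complex-valued $f\in C^1(0,\infty)$ such that $f'$ is absolutely continuous on every compact interval $[a,b]$ with $0<a<b<\infty$ and $$\|f\|_0^2:=\int_0^\infty\left(r|f''(r)|^2+\frac1r|f'(r)|^2\right)dr<\infty.$$ Every $f\in\Lambda_0$ extends continuously to $r=0$, and $f(0)$ denotes the value of this extension. Define the differential operators $$L_0=r\frac{d^4}{dr^4}+2\frac{d^3}{dr^3}-\frac1r\frac{d^2}{dr^2}+\frac1{r^2}\frac{d}{dr},\quad G_0=\frac{d^3}{dr^3}-\frac1r\frac{d^2}{dr^2}+\frac1{r^2}\frac{d}{dr},\quad R_0=\frac1r\left[\frac{d^2}{dr^2}+\frac1r\frac{d}{dr}\right].$$ On any open subinterval of $(0,\infty)$ their null spaces are $\mathrm{Ker}\,L_0=\mathrm{span}\{r^2,r^2\ln r,1,\ln r\}$, $\mathrm{Ker}\,G_0=\mathrm{span}\{r^2,r^2\ln r,1\}$, $\mathrm{Ker}\,R_0=\mathrm{span}\{1,\ln r\}$. For knots $\rho=\{r_1<\cdots<r_n\}\subset(0,\infty)$, a function $\eta:[0,\infty)\to\mathbb{C}$, continuous at $0$, is called a Beppo Levi $L_0$-spline on $\rho$ if: (i) $L_0\eta(r)=0$ for all $r\in(r_j,r_{j+1})$ and all $j\in\{1,\ldots,n-1\}$; (ii) $G_0\eta(r)=0$ for all $r\in(0,r_1)$ and $R_0\eta(r)=0$ for all $r>r_n$; (iii) $\eta$ is $C^2$-continuous at each knot $r_1,\ldots,r_n$. The set of all such functions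 is $\mathcal{S}_0(\rho)\subset\Lambda_0$. A spline $\eta\in\mathcal{S}_0(\rho)$ is called non-singular if its restriction to $(0,r_1)$ belongs to $\mathrm{span}\{r^2,1\}$. For arbitrary real data, the splines $\sigma^A$ and $\sigma^B$ described in the claim exist and are unique. *)

theory Defs
  imports "HOL-Analysis.Analysis"
begin

text \<open>Functions on the open or closed half-line are total functions on the reals; only their values
  on the half-line in question are ever used. The \<open>k\<close>-th derivative is a total
  function as well (junk values where the derivative does not exist), so differentiability is always
  demanded separately.\<close>

definition nderiv :: "nat \<Rightarrow> (real \<Rightarrow> complex) \<Rightarrow> real \<Rightarrow> complex" where
  "nderiv k f = ((\<lambda>g x. vector_derivative g (at x)) ^^ k) f"

definition times_differentiable_on :: "nat \<Rightarrow> (real \<Rightarrow> complex) \<Rightarrow> real set \<Rightarrow> bool" where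
  "times_differentiable_on k f S \<longleftrightarrow> (\<forall>i<k. \<forall>x\<in>S. nderiv i f differentiable (at x))"

definition abs_continuous_on_interval :: "real \<Rightarrow> real \<Rightarrow> (real \<Rightarrow> complex) \<Rightarrow> bool" where
  "abs_continuous_on_interval a b f \<longleftrightarrow>
     (\<forall>\<epsilon>>0. \<exists>\<delta>>0. \<forall>(m::nat) u v.
        (\<forall>i<m. a \<le> u i \<and> u i \<le> v i \<and> v i \<le> b) \<longrightarrow>
        disjoint_family_on (\<lambda>i. {u i<..<v i}) {..<m} \<longrightarrow>
        (\<Sum>i<m. v i - u i) < \<delta> \<longrightarrow>
        (\<Sum>i<m. norm (f (v i) - f (u i))) < \<epsilon>)"

text \<open>If the first derivative of \<open>f\<close> is locally absolutely continuous, the second derivative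
  exists almost everywhere, so the junk values do not affect the integrals below.\<close>

definition energy0 :: "(real \<Rightarrow> complex) \<Rightarrow> real \<Rightarrow> real" where
  "energy0 f r = r * (norm (nderiv 2 f r))\<^sup>2 + (1 / r) * (norm (nderiv 1 f r))\<^sup>2"

definition norm0 :: "(real \<Rightarrow> complex) \<Rightarrow> real" where
  "norm0 f = sqrt (LINT r:{0<..}|lebesgue. energy0 f r)"

definition Lambda0 :: "(real \<Rightarrow> complex) set" where
  "Lambda0 = {f. f C1_differentiable_on {0<..}
               \<and> (\<forall>a b. 0 < a \<and> a < b \<longrightarrow> abs_continuous_on_interval a b (nderiv 1 f))
               \<and> set_integrable lebesgue {0<..} (energy0 f)}"

definition L0 :: "(real \<Rightarrow> complex) \<Rightarrow> real \<Rightarrow> complex" where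
  "L0 f r = r *\<^sub>R nderiv 4 f r + 2 *\<^sub>R nderiv 3 f r
            - (1 / r) *\<^sub>R nderiv 2 f r + (1 / r\<^sup>2) *\<^sub>R nderiv 1 f r"

definition G0 :: "(real \<Rightarrow> complex) \<Rightarrow> real \<Rightarrow> complex" where
  "G0 f r = nderiv 3 f r - (1 / r) *\<^sub>R nderiv 2 f r + (1 / r\<^sup>2) *\<^sub>R nderiv 1 f r"

definition R0 :: "(real \<Rightarrow> complex) \<Rightarrow> real \<Rightarrow> complex" where
  "R0 f r = (1 / r) *\<^sub>R (nderiv 2 f r + (1 / r) *\<^sub>R nderiv 1 f r)"

definition C2_at :: "(real \<Rightarrow> complex) \<Rightarrow> real \<Rightarrow> bool" where
  "C2_at f x \<longleftrightarrow>
     (\<forall>\<^sub>F y in nhds x. times_differentiable_on 2 f {y}) \<and> isCont (nderiv 2 f) x"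

text \<open>The knots are \<open>\<rho> 1 < \<dots> < \<rho> n\<close>; other values of \<open>\<rho>\<close> are irrelevant.\<close>

definition S0 :: "nat \<Rightarrow> (nat \<Rightarrow> real) \<Rightarrow> (real \<Rightarrow> complex) set" where
  "S0 n \<rho> = {\<eta>.
     continuous (at_right 0) \<eta>
     \<and> (\<forall>j\<in>{1..<n}. times_differentiable_on 4 \<eta> {\<rho> j<..<\<rho> (j + 1)}
          \<and> (\<forall>r\<in>{\<rho> j<..<\<rho> (j + 1)}. L0 \<eta> r = 0))
     \<and> times_differentiable_on 3 \<eta> {0<..<\<rho> 1} \<and> (\<forall>r\<in>{0<..<\<rho> 1}. G0 \<eta> r = 0)
     \<and> times_differentiable_on 2 \<eta> {\<rho> n<..} \<and> (\<forall>r\<in>{\<rho> n<..}. R0 \<eta> r = 0)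
     \<and> (\<forall>j\<in>{1..n}. C2_at \<eta> (\<rho> j))}"

definition nonsingular_spline :: "(nat \<Rightarrow> real) \<Rightarrow> (real \<Rightarrow> complex) \<Rightarrow> bool" where
  "nonsingular_spline \<rho> \<eta> \<longleftrightarrow>
     (\<exists>c d :: complex. \<forall>r\<in>{0<..<\<rho> 1}. \<eta> r = c * (of_real r)\<^sup>2 + d)"

end

theory Submission
  imports Defs
begin

text \<open>The norm comes from a semi-inner product, and the claim is a Pythagorean theorem: if \<open>\<sigma>\<close> is one of the two
splines and \<open>h = f - \<sigma>\<close>, then \<open>h\<close> is orthogonal to \<open>\<sigma>\<close>, so that the energy of \<open>f\<close> is the sum of the energies of
\<open>\<sigma>\<close> and \<open>h\<close>. If \<open>h\<close> had zero energy, \<open>h'\<close> would vanish and \<open>h\<close>, being zero at the knots, would vanish as well.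

Orthogonality is integration by parts. The equation \<open>L0 \<sigma> = 0\<close> integrates once to the statement that the flux
\<open>w = (r \<sigma>'')' - \<sigma>' / r\<close> is constant on each piece, whence \<open>r \<sigma>'' \<bullet> h' - w \<bullet> h\<close> is an antiderivative of
\<open>r \<sigma>'' \<bullet> h'' + \<sigma>' \<bullet> h' / r\<close> (\<open>integration_by_parts_on_piece\<close>). Over the pieces these boundary terms telescope
(\<open>orthogonality_on_interval\<close>), because \<open>\<sigma>''\<close> is continuous and \<open>h\<close> is zero at the knots. What remains is the behaviour
at the two ends. There \<open>r \<sigma>''\<close> tends to zero by the explicit solutions of \<open>G0 \<sigma> = 0\<close> and \<open>R0 \<sigma> = 0\<close>, while \<open>h'\<close> stays
bounded because a function of finite energy has a bounded derivative (\<open>Lambda0_derivative_bounded\<close>). The flux is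
zero beyond the last knot. At zero the term \<open>w \<bullet> h(0)\<close> is left over; it is zero for \<open>\<sigma>A\<close> since \<open>h(0) = 0\<close>, and for
\<open>\<sigma>B\<close> since \<open>w = 0\<close>.

The integration by parts needs the calculus of absolutely continuous functions: \<open>f'\<close> is
differentiable almost everywhere and is recovered from its derivative by integration. Differentiability is
derived from the Vitali covering theorem by comparing two fillings of the set where the upper and the lower
derivative differ (\<open>negligible_steep_both\<close>), and the fundamental theorem of calculus follows by a gauge argument
(\<open>ac_on_fundamental_theorem\<close>).\<close>

section \<open>Absolute continuity in terms of divisions\<close>

text \<open>Families of intervals are recorded as divisions of their union, so that partial divisions can be
completed with the lemmas on divisions. Degenerate intervals are allowed in a division, which is
harmless because their increments vanish. The codomain is an arbitrary normed space because real
inner products of complex functions have to be covered as well.\<close>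

definition ac_on :: "real \<Rightarrow> real \<Rightarrow> (real \<Rightarrow> 'a::real_normed_vector) \<Rightarrow> bool" where
  "ac_on a b F \<longleftrightarrow> (\<forall>e>0. \<exists>d>0. \<forall>D. D division_of \<Union>D \<longrightarrow> \<Union>D \<subseteq> {a..b} \<longrightarrow>
     measure lebesgue (\<Union>D) < d \<longrightarrow> (\<Sum>K\<in>D. norm (F (Sup K) - F (Inf K))) < e)"

lemma ac_onE:
  assumes "ac_on a b F" "0 < e"
  obtains d where "0 < d" "\<And>D. \<lbrakk>D division_of \<Union>D; \<Union>D \<subseteq> {a..b}; measure lebesgue (\<Union>D) < d\<rbrakk>
    \<Longrightarrow> (\<Sum>K\<in>D. norm (F (Sup K) - F (Inf K))) < e"
  using assms unfolding ac_on_def by meson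

lemma division_element_real:
  fixes K :: "real set"
  assumes "D division_of S" "K \<in> D"
  obtains u v where "u \<le> v" "K = {u..v}" "Sup K = v" "Inf K = u"
proof -
  obtain u v where uv: "K = cbox u v" "K \<noteq> {}"
    using division_ofD(3,4)[OF assms] by auto
  then have "u \<le> v" by auto
  with uv show thesis by (intro that[of u v]) auto
qed

lemma abs_continuous_imp_ac_on:
  assumes "abs_continuous_on_interval a b F"
  shows "ac_on a b F"
  unfolding ac_on_def
proof (intro allI impI)
  fix e :: real assume "e > 0"
  then obtain \<delta> where "\<delta> > 0" and \<delta>: "\<And>(m::nat) u v. (\<forall>i<m. a \<le> u i \<and> u i \<le> v i \<and> v i \<le> b) \<Longrightarrow>
        disjoint_family_on (\<lambda>i. {u i<..<v i}) {..<m} \<Longrightarrow> (\<Sum>i<m. v i - u i) < \<delta> \<Longrightarrow>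
        (\<Sum>i<m. norm (F (v i) - F (u i))) < e"
    using assms unfolding abs_continuous_on_interval_def by meson
  show "\<exists>d>0. \<forall>D. D division_of \<Union>D \<longrightarrow> \<Union>D \<subseteq> {a..b} \<longrightarrow>
     measure lebesgue (\<Union>D) < d \<longrightarrow> (\<Sum>K\<in>D. norm (F (Sup K) - F (Inf K))) < e"
  proof (intro exI[of _ \<delta>] conjI allI impI, fact)
    fix D :: "real set set"
    assume D: "D division_of \<Union>D" "\<Union>D \<subseteq> {a..b}" and small: "measure lebesgue (\<Union>D) < \<delta>"
    have "finite D" using D by blast
    then obtain g where g: "bij_betw g {..<card D} D"
      using ex_bij_betw_nat_finite lessThan_atLeast0 by metis
    have gD: "g i \<in> D" if "i < card D" for i
      using g that by (auto simp: bij_betw_def)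
    have eqs: "(\<Sum>K\<in>D. w K) = (\<Sum>i<card D. w (g i))" for w :: "real set \<Rightarrow> real"
      using sum.reindex_bij_betw[OF g] by metis
    have el: "a \<le> Inf K \<and> Inf K \<le> Sup K \<and> Sup K \<le> b \<and> interior K = {Inf K<..<Sup K}
        \<and> measure lebesgue K = Sup K - Inf K" if "K \<in> D" for K
    proof -
      obtain u v where K: "u \<le> v" "K = {u..v}" "Sup K = v" "Inf K = u"
        using division_element_real[OF D(1) \<open>K \<in> D\<close>] .
      moreover have "K \<subseteq> {a..b}" using D that by blast
      ultimately show ?thesis by auto
    qed
    show "(\<Sum>K\<in>D. norm (F (Sup K) - F (Inf K))) < e"
      unfolding eqs
    proof (rule \<delta>)
      show "\<forall>i<card D. a \<le> Inf (g i) \<and> Inf (g i) \<le> Sup (g i) \<and> Sup (g i) \<le> b"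
        using el gD by blast
      show "disjoint_family_on (\<lambda>i. {Inf (g i)<..<Sup (g i)}) {..<card D}"
        unfolding disjoint_family_on_def
      proof (intro ballI impI)
        fix i j assume ij: "i \<in> {..<card D}" "j \<in> {..<card D}" "i \<noteq> j"
        then have "g i \<noteq> g j" using g by (auto simp: bij_betw_def inj_on_def)
        then have "interior (g i) \<inter> interior (g j) = {}"
          using division_ofD(5)[OF D(1)] gD ij by auto
        then show "{Inf (g i)<..<Sup (g i)} \<inter> {Inf (g j)<..<Sup (g j)} = {}"
          using el gD ij by (metis lessThan_iff)
      qed
      have "(\<Sum>i<card D. Sup (g i) - Inf (g i)) = (\<Sum>K\<in>D. measure lebesgue K)"
        unfolding eqs using el gD by (intro sum.cong) auto
      also have "\<dots> = measure lebesgue (\<Union>D)" using content_division[OF D(1)] .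
      finally show "(\<Sum>i<card D. Sup (g i) - Inf (g i)) < \<delta>" using small by simp
    qed
  qed
qed

text \<open>All closure properties of absolute continuity below come from this one comparison of increments.\<close>

lemma ac_on_dominated:
  assumes G: "ac_on a b G" and H: "ac_on a b H"
    and dom: "\<And>u v. a \<le> u \<Longrightarrow> u \<le> v \<Longrightarrow> v \<le> b \<Longrightarrow>
      norm (F v - F u) \<le> C * (norm (G v - G u) + norm (H v - H u))"
  shows "ac_on a b F"
  unfolding ac_on_def
proof (intro allI impI)
  fix e :: real assume "e > 0"
  define c where "c = e / (\<bar>C\<bar> + 1) / 2"
  have "\<bar>C\<bar> + 1 \<noteq> 0" by simp
  then have ce: "(\<bar>C\<bar> + 1) * (c + c) = e"
    unfolding c_def field_sum_of_halves by (metis times_divide_eq_right nonzero_mult_div_cancel_left)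
  have "c > 0" using \<open>e > 0\<close> by (simp add: c_def)
  obtain d1 where d1: "0 < d1" "\<And>D. D division_of \<Union>D \<Longrightarrow> \<Union>D \<subseteq> {a..b} \<Longrightarrow> measure lebesgue (\<Union>D) < d1
    \<Longrightarrow> (\<Sum>K\<in>D. norm (G (Sup K) - G (Inf K))) < c" using ac_onE[OF G \<open>c > 0\<close>] by blast
  obtain d2 where d2: "0 < d2" "\<And>D. D division_of \<Union>D \<Longrightarrow> \<Union>D \<subseteq> {a..b} \<Longrightarrow> measure lebesgue (\<Union>D) < d2
    \<Longrightarrow> (\<Sum>K\<in>D. norm (H (Sup K) - H (Inf K))) < c" using ac_onE[OF H \<open>c > 0\<close>] by blast
  show "\<exists>d>0. \<forall>D. D division_of \<Union>D \<longrightarrow> \<Union>D \<subseteq> {a..b} \<longrightarrow>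
     measure lebesgue (\<Union>D) < d \<longrightarrow> (\<Sum>K\<in>D. norm (F (Sup K) - F (Inf K))) < e"
  proof (intro exI[of _ "min d1 d2"] conjI allI impI)
    fix D :: "real set set"
    assume D: "D division_of \<Union>D" "\<Union>D \<subseteq> {a..b}" and small: "measure lebesgue (\<Union>D) < min d1 d2"
    have "norm (F (Sup K) - F (Inf K)) \<le> (\<bar>C\<bar>+1) * (norm (G (Sup K) - G (Inf K)) + norm (H (Sup K) - H (Inf K)))"
      if "K \<in> D" for K
    proof -
      obtain u v where K: "u \<le> v" "K = {u..v}" "Sup K = v" "Inf K = u"
        using division_element_real[OF D(1) \<open>K \<in> D\<close>] .
      moreover have "K \<subseteq> {a..b}" using D that by blast
      ultimately have "norm (F (Sup K) - F (Inf K)) \<le> C * (norm (G (Sup K) - G (Inf K)) + norm (H (Sup K) - H (Inf K)))"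
        using dom[of u v] by auto
      also have "\<dots> \<le> (\<bar>C\<bar>+1) * (norm (G (Sup K) - G (Inf K)) + norm (H (Sup K) - H (Inf K)))"
        by (intro mult_right_mono) auto
      finally show ?thesis .
    qed
    then have "(\<Sum>K\<in>D. norm (F (Sup K) - F (Inf K)))
      \<le> (\<Sum>K\<in>D. (\<bar>C\<bar>+1) * (norm (G (Sup K) - G (Inf K)) + norm (H (Sup K) - H (Inf K))))"
      by (intro sum_mono)
    also have "\<dots> = (\<bar>C\<bar>+1) * ((\<Sum>K\<in>D. norm (G (Sup K) - G (Inf K))) + (\<Sum>K\<in>D. norm (H (Sup K) - H (Inf K))))"
      by (simp only: sum_distrib_left sum.distrib distrib_left)
    also have "\<dots> < (\<bar>C\<bar>+1) * (c + c)"
      using d1(2)[OF D] d2(2)[OF D] small by (intro mult_strict_left_mono) auto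
    also note ce
    finally show "(\<Sum>K\<in>D. norm (F (Sup K) - F (Inf K))) < e" .
  qed (use d1 d2 in auto)
qed

lemma ac_on_contraction:
  assumes "ac_on a b G" and "\<And>u v. norm (F v - F u) \<le> norm (G v - G u)"
  shows "ac_on a b F"
proof (rule ac_on_dominated[OF assms(1) assms(1), where C = 1])
  fix u v
  show "norm (F v - F u) \<le> 1 * (norm (G v - G u) + norm (G v - G u))"
    using add_increasing2[OF norm_ge_zero assms(2)[of v u]] unfolding mult_1 .
qed

lemma ac_on_ident: "ac_on a b (\<lambda>x::real. x)"
  unfolding ac_on_def
proof (intro allI impI exI conjI)
  fix e :: real and D :: "real set set"
  assume "0 < e" then show "0 < e" .
  assume D: "D division_of \<Union>D" and small: "measure lebesgue (\<Union>D) < e"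
  have "norm (Sup K - Inf K) = measure lebesgue K" if "K \<in> D" for K
    by (rule division_element_real[OF D that]) simp
  then have "(\<Sum>K\<in>D. norm (Sup K - Inf K)) = measure lebesgue (\<Union>D)"
    using content_division[OF D] by simp
  with small show "(\<Sum>K\<in>D. norm (Sup K - Inf K)) < e" by simp
qed

lemma ac_on_lipschitz:
  assumes "\<And>u v. a \<le> u \<Longrightarrow> u \<le> v \<Longrightarrow> v \<le> b \<Longrightarrow> norm (F v - F u) \<le> C * (v - u)"
  shows "ac_on a b F"
proof (rule ac_on_dominated[OF ac_on_ident ac_on_ident, where C = "C / 2"])
  fix u v assume "a \<le> u" "u \<le> v" "v \<le> b"
  with assms[of u v] show "norm (F v - F u) \<le> C / 2 * (norm (v - u) + norm (v - u))"
    by (simp add: algebra_simps)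
qed

lemma ac_on_single:
  assumes "ac_on a b F" "0 < e"
  obtains d where "0 < d" "\<And>u v. a \<le> u \<Longrightarrow> u \<le> v \<Longrightarrow> v \<le> b \<Longrightarrow> v - u < d \<Longrightarrow> norm (F v - F u) < e"
proof -
  obtain d where d: "0 < d" "\<And>D. D division_of \<Union>D \<Longrightarrow> \<Union>D \<subseteq> {a..b} \<Longrightarrow> measure lebesgue (\<Union>D) < d
    \<Longrightarrow> (\<Sum>K\<in>D. norm (F (Sup K) - F (Inf K))) < e" using ac_onE[OF assms] by blast
  show thesis
  proof (rule that[OF d(1)])
    fix u v assume uv: "a \<le> u" "u \<le> v" "v \<le> b" "v - u < d"
    have "{{u..v}} division_of \<Union>{{u..v}}"
      using division_of_self[of u v] uv by (simp add: box_real)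
    from d(2)[OF this] uv show "norm (F v - F u) < e" by simp
  qed
qed

lemma ac_on_continuous:
  assumes "ac_on a b F" shows "continuous_on {a..b} F"
  unfolding continuous_on_iff
proof (intro ballI allI impI)
  fix x e :: real assume x: "x \<in> {a..b}" and "0 < e"
  obtain d where d: "0 < d" "\<And>u v. a \<le> u \<Longrightarrow> u \<le> v \<Longrightarrow> v \<le> b \<Longrightarrow> v - u < d \<Longrightarrow> norm (F v - F u) < e"
    using ac_on_single[OF assms \<open>0 < e\<close>] by blast
  show "\<exists>d>0. \<forall>x'\<in>{a..b}. dist x' x < d \<longrightarrow> dist (F x') (F x) < e"
  proof (intro exI[of _ d] conjI ballI impI, fact)
    fix y assume "y \<in> {a..b}" "dist y x < d"
    then show "dist (F y) (F x) < e"
      using d(2)[of x y] d(2)[of y x] x norm_minus_commute[of "F x" "F y"]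
      by (cases "x \<le> y") (auto simp: dist_norm)
  qed
qed

lemma ac_on_inner:
  fixes F G :: "real \<Rightarrow> 'a::real_inner"
  assumes F: "ac_on a b F" and G: "ac_on a b G"
  shows "ac_on a b (\<lambda>x. F x \<bullet> G x)"
proof -
  have "bounded (F ` {a..b})" "bounded (G ` {a..b})"
    using ac_on_continuous[OF F] ac_on_continuous[OF G] by (auto intro: compact_imp_bounded compact_continuous_image)
  then obtain B1 B2 where B: "\<And>x. x \<in> {a..b} \<Longrightarrow> norm (F x) \<le> B1" "\<And>x. x \<in> {a..b} \<Longrightarrow> norm (G x) \<le> B2"
    unfolding bounded_iff by blast
  show ?thesis
  proof (rule ac_on_dominated[OF F G, where C = "max B1 B2"])
    fix u v assume uv: "a \<le> u" "u \<le> v" "v \<le> b"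
    have "norm (F v \<bullet> G v - F u \<bullet> G u) = norm ((F v - F u) \<bullet> G v + F u \<bullet> (G v - G u))"
      by (simp add: inner_diff_left inner_diff_right)
    also have "\<dots> \<le> norm (F v - F u) * norm (G v) + norm (F u) * norm (G v - G u)"
      by (intro norm_triangle_le add_mono) (auto simp: Cauchy_Schwarz_ineq2)
    also have "\<dots> \<le> norm (F v - F u) * max B1 B2 + max B1 B2 * norm (G v - G u)"
      using B(1)[of u] B(2)[of v] uv
      by (intro add_mono mult_left_mono mult_right_mono) auto
    finally show "norm (F v \<bullet> G v - F u \<bullet> G u) \<le> max B1 B2 * (norm (F v - F u) + norm (G v - G u))"
      by (simp add: algebra_simps)
  qed
qed

lemma ac_on_diff:
  assumes "ac_on a b F" "ac_on a b G"
  shows "ac_on a b (\<lambda>x. F x - G x)"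
proof (rule ac_on_dominated[OF assms, where C = 1])
  fix u v
  have "F v - G v - (F u - G u) = (F v - F u) - (G v - G u)" by simp
  then show "norm (F v - G v - (F u - G u)) \<le> 1 * (norm (F v - F u) + norm (G v - G u))"
    using norm_triangle_ineq4[of "F v - F u" "G v - G u"] by (metis mult_1)
qed

lemma sum_division_increments:
  fixes F :: "real \<Rightarrow> 'a::real_normed_vector"
  assumes D: "D division_of {a..b}" and "a \<le> b"
  shows "(\<Sum>K\<in>D. F (Sup K) - F (Inf K)) = F b - F a"
proof -
  let ?p = "(\<lambda>K. (Inf K, K)) ` D"
  have "?p tagged_division_of {a..b}"
    unfolding tagged_division_of
  proof (intro conjI allI impI)
    show "finite ?p" using D by blast
    fix x K assume xK: "(x, K) \<in> ?p"
    obtain u v where K: "u \<le> v" "K = {u..v}" "Sup K = v" "Inf K = u"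
        using division_element_real[OF D, of K] xK by auto
    show "x \<in> K" "K \<subseteq> {a..b}" "\<exists>u v. K = cbox u v"
      using K xK division_ofD(2)[OF D, of K] by (auto simp flip: box_real)
  next
    fix x K x' K' assume "(x, K) \<in> ?p \<and> (x', K') \<in> ?p \<and> (x, K) \<noteq> (x', K')"
    then show "interior K \<inter> interior K' = {}"
      using division_ofD(5)[OF D, of K K'] by auto
  next
    have "{K. \<exists>x. (x, K) \<in> ?p} = D" by auto
    then show "\<Union>{K. \<exists>x. (x, K) \<in> ?p} = {a..b}"
      using division_ofD(6)[OF D] by simp
  qed
  from additive_tagged_division_1[OF \<open>a \<le> b\<close> this, of F]
  have "F b - F a = (\<Sum>(x, K)\<in>?p. F (Sup K) - F (Inf K))" by simp
  also have "\<dots> = (\<Sum>K\<in>D. F (Sup K) - F (Inf K))"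
    by (subst sum.reindex) (auto simp: inj_on_def)
  finally show ?thesis by simp
qed

text \<open>The sum of the increments depends only on the union: completing both divisions by the same family to
divisions of the whole interval gives two telescoping sums with the same value. The two families that
are united may share degenerate intervals, but those contribute nothing.\<close>

lemma sum_increments_same_union:
  fixes F :: "real \<Rightarrow> 'a::real_normed_vector"
  assumes D: "D division_of S" and E: "E division_of S" and S: "S \<subseteq> {a..b}" and "a \<le> b"
  shows "(\<Sum>K\<in>D. F (Sup K) - F (Inf K)) = (\<Sum>K\<in>E. F (Sup K) - F (Inf K))"
proof -
  have "{{a..b}} division_of {a..b}"
    using division_of_self[of a b] \<open>a \<le> b\<close> by (simp add: box_real)
  then obtain P where P: "D \<subseteq> P" "P division_of {a..b}"
    using partial_division_extend[OF D _ S] by metis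
  let ?R = "P - D"
  have R: "?R division_of \<Union>?R"
    using division_of_subset[of P ?R] division_ofD(6)[OF P(2)] P(2) by auto
  have DR: "interior K \<inter> interior L = {}" if "K \<in> D" "L \<in> ?R" for K L
    using division_ofD(5)[OF P(2), of K L] that P(1) by auto
  have SD: "S = \<Union>D" and SE: "S = \<Union>E" using D E by blast+
  have "interior K \<inter> interior (\<Union>?R) = {}" if "K \<in> D" for K
    by (rule Int_interior_Union_intervals) (use R DR that in blast)+
  then have "interior (\<Union>?R) \<inter> interior (\<Union>D) = {}"
    by (intro Int_interior_Union_intervals) (use D in blast)+
  then have int: "interior S \<inter> interior (\<Union>?R) = {}"
    unfolding SD by blast
  have "S \<union> \<Union>?R = {a..b}" using division_ofD(6)[OF P(2)] P(1) SD by blast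
  then have ER: "(E \<union> ?R) division_of {a..b}"
    using division_disjoint_union[OF E R int] by simp
  have "F (Sup K) - F (Inf K) = 0" if "K \<in> E \<inter> ?R" for K
  proof -
    have "interior K \<subseteq> interior S" "interior K \<subseteq> interior (\<Union>?R)"
      using that SE by (auto intro!: interior_mono)
    then have "interior K = {}" using int by blast
    moreover obtain u v where "u \<le> v" "K = {u..v}" "Sup K = v" "Inf K = u"
      using \<open>K \<in> E \<inter> ?R\<close> by (blast intro: division_element_real[OF E, of K])
    ultimately show ?thesis by auto
  qed
  then have "(\<Sum>K\<in>E \<union> ?R. F (Sup K) - F (Inf K)) =
      (\<Sum>K\<in>E. F (Sup K) - F (Inf K)) + (\<Sum>K\<in>?R. F (Sup K) - F (Inf K))"
    using E R by (intro sum.union_inter_neutral) blast+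
  moreover have "(\<Sum>K\<in>P. F (Sup K) - F (Inf K)) =
      (\<Sum>K\<in>?R. F (Sup K) - F (Inf K)) + (\<Sum>K\<in>D. F (Sup K) - F (Inf K))"
    using P by (intro sum.subset_diff) blast+
  ultimately show ?thesis
    using sum_division_increments[OF ER \<open>a \<le> b\<close>, of F] sum_division_increments[OF P(2) \<open>a \<le> b\<close>, of F]
    by simp
qed

section \<open>Vitali coverings and steep points\<close>

lemma lmeasurable_open_superset:
  fixes E :: "real set"
  assumes E: "E \<in> lmeasurable" and "0 < e"
  obtains T where "open T" "E \<subseteq> T" "T \<in> lmeasurable" "measure lebesgue T < measure lebesgue E + e"
proof -
  obtain T where T: "open T" "E \<subseteq> T" "T - E \<in> lmeasurable" "emeasure lebesgue (T - E) < ennreal e"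
    using sets_lebesgue_outer_open[OF fmeasurableD[OF E] \<open>0 < e\<close>] .
  have small: "measure lebesgue (T - E) < e"
    using T(3,4) \<open>0 < e\<close> by (simp add: emeasure_eq_measure2 ennreal_less_iff)
  have TE: "T = E \<union> (T - E)" using T(2) by blast
  have "T \<in> lmeasurable" using fmeasurable.Un[OF E T(3)] TE by simp
  moreover have "measure lebesgue T \<le> measure lebesgue E + measure lebesgue (T - E)"
    using measure_Un_le[of E lebesgue "T - E"] E T(3) TE by (simp add: fmeasurableD)
  ultimately show thesis using that[OF T(1,2)] small by simp
qed

text \<open>The Vitali covering theorem, cut down to finitely many intervals at the price of a small measure.
The covered part of the set is measured inside the interior of the union, because the lemma is
applied a second time inside that open set.\<close>

lemma vitali_finite_division:
  fixes E U :: "real set"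
  assumes E: "E \<in> lmeasurable" and U: "open U" "E \<subseteq> U" and "0 < e"
    and cover: "\<And>x d. x \<in> E \<Longrightarrow> 0 < d \<Longrightarrow> \<exists>u v. u < x \<and> x < v \<and> v - u < d \<and> P u v"
  obtains D where "D division_of \<Union>D" "\<Union>D \<subseteq> U" "\<And>K. K \<in> D \<Longrightarrow> P (Inf K) (Sup K)"
    "measure lebesgue E - e < measure lebesgue (E \<inter> interior (\<Union>D))"
proof -
  define I where "I = {(c, r). 0 < r \<and> cball c r \<subseteq> U \<and> P (c - r) (c + r)}"
  have "\<exists>i. i \<in> I \<and> x \<in> cball (fst i) (snd i) \<and> snd i < d" if "x \<in> E" "0 < d" for x d
  proof -
    obtain e0 where e0: "0 < e0" "ball x e0 \<subseteq> U"
      using U \<open>x \<in> E\<close> by (meson openE subsetD)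
    have "0 < min d e0" using that e0 by simp
    with cover[OF \<open>x \<in> E\<close>] obtain u v where uv: "u < x" "x < v" "v - u < min d e0" "P u v"
      by blast
    define c r where "c = (u + v) / 2" and "r = (v - u) / 2"
    have cr: "c - r = u" "c + r = v" "0 < r" "r < d"
      using uv by (auto simp: c_def r_def field_simps)
    then have cb: "cball c r = {u..v}" by (simp add: cball_eq_atLeastAtMost)
    then have "cball c r \<subseteq> ball x e0" using uv by (auto simp: dist_real_def)
    then have "(c, r) \<in> I" using cr uv e0 by (auto simp: I_def)
    moreover have "x \<in> cball c r" using uv cb by auto
    ultimately show ?thesis using cr by (intro exI[of _ "(c, r)"]) auto
  qed
  then obtain C where C: "countable C" "C \<subseteq> I"
     "pairwise (\<lambda>i j. disjnt (cball (fst i) (snd i)) (cball (fst j) (snd j))) C"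
     "negligible (E - (\<Union>i\<in>C. cball (fst i) (snd i)))"
    using Vitali_covering_theorem_cballs[of I snd E fst] by (force simp: I_def)
  let ?B = "\<lambda>i. cball (fst i) (snd i)"
  have B: "E \<inter> ?B i \<in> lmeasurable" for i
    using E by (intro fmeasurable.Int) auto
  have "measure lebesgue (\<Union>D') \<le> measure lebesgue E"
    if "D' \<subseteq> (\<lambda>i. E \<inter> ?B i) ` C" "finite D'" for D'
    using that B E by (intro measure_mono_fmeasurable) (auto intro!: fmeasurableD fmeasurable.finite_Union)
  note bound = this
  obtain D' where D': "D' \<subseteq> (\<lambda>i. E \<inter> ?B i) ` C" "finite D'"
      "measure lebesgue (\<Union>((\<lambda>i. E \<inter> ?B i) ` C)) - e < measure lebesgue (\<Union>D')"
  proof (rule measure_countable_Union_approachable)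
    show "countable ((\<lambda>i. E \<inter> ?B i) ` C)" using C(1) by simp
    show "0 < e" by fact
    show "d \<in> lmeasurable" if "d \<in> (\<lambda>i. E \<inter> ?B i) ` C" for d using that B by blast
    show "measure lebesgue (\<Union>D') \<le> measure lebesgue E"
      if "D' \<subseteq> (\<lambda>i. E \<inter> ?B i) ` C" "finite D'" for D' using bound[OF that] .
  qed
  obtain C' where C': "C' \<subseteq> C" "finite C'" "D' = (\<lambda>i. E \<inter> ?B i) ` C'"
    using finite_subset_image[OF D'(2,1)] by blast
  have "measure lebesgue (\<Union>((\<lambda>i. E \<inter> ?B i) ` C)) = measure lebesgue E"
  proof (rule measure_negligible_symdiff[OF E])
    show "negligible (sym_diff E (\<Union>((\<lambda>i. E \<inter> ?B i) ` C)))"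
      by (rule negligible_subset[OF C(4)]) auto
  qed
  define D where "D = ?B ` C'"
  have K: "\<exists>u v. u < v \<and> K = {u..v} \<and> P u v" if "K \<in> D" for K
  proof -
    obtain i where "i \<in> C'" "K = ?B i" using \<open>K \<in> D\<close> unfolding D_def by blast
    moreover have "i \<in> I" using \<open>i \<in> C'\<close> C' C by blast
    ultimately show ?thesis
      by (intro exI[of _ "fst i - snd i"] exI[of _ "fst i + snd i"])
        (auto simp: I_def cball_eq_atLeastAtMost)
  qed
  have div: "D division_of \<Union>D"
    unfolding division_of_def
  proof (intro conjI ballI impI)
    show "finite D" using C' by (simp add: D_def)
    fix K assume "K \<in> D"
    with K obtain u v where "u < v" "K = {u..v}" by blast
    then show "K \<noteq> {}" "\<exists>a b. K = cbox a b" "K \<subseteq> \<Union>D"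
      using \<open>K \<in> D\<close> box_real(2)[of u v] by (auto simp del: box_real)
  next
    fix K L assume "K \<in> D" "L \<in> D" "K \<noteq> L"
    then obtain i j where ij: "i \<in> C" "j \<in> C" "K = ?B i" "L = ?B j"
      using C'(1) unfolding D_def by blast
    with \<open>K \<noteq> L\<close> have "i \<noteq> j" by blast
    then have "K \<inter> L = {}"
      using pairwiseD[OF C(3) ij(1,2)] ij(3,4) unfolding disjnt_def by blast
    then show "interior K \<inter> interior L = {}"
      using interior_subset by blast
  qed simp
  show thesis
  proof (rule that[OF div])
    have "?B i \<subseteq> U" if "i \<in> C'" for i
    proof -
      have "i \<in> I" using that C'(1) C(2) by blast
      then show ?thesis by (cases i) (simp add: I_def)
    qed
    then show "\<Union>D \<subseteq> U" unfolding D_def by blast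
    show "P (Inf K) (Sup K)" if "K \<in> D" for K
      using K[OF that] by force
    have neg: "negligible (frontier (\<Union>D))"
    proof (rule negligible_subset)
      show "frontier (\<Union>D) \<subseteq> \<Union>(frontier ` D)"
        using frontier_Union_subset[of D] div by auto
      show "negligible (\<Union>(frontier ` D))"
        using div K by (intro negligible_Union) (auto intro!: negligible_convex_frontier)
    qed
    have "measure lebesgue (E \<inter> interior (\<Union>D)) = measure lebesgue (\<Union>D')"
    proof (rule measure_negligible_symdiff)
      have D'E: "\<Union>D' = E \<inter> \<Union>D" by (auto simp: C'(3) D_def)
      show "\<Union>D' \<in> lmeasurable"
        using D'(2) C'(3) B by (intro fmeasurable.finite_Union) auto
      show "negligible (sym_diff (\<Union>D') (E \<inter> interior (\<Union>D)))"
        unfolding D'E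
        using interior_subset[of "\<Union>D"] closure_subset[of "\<Union>D"]
        by (intro negligible_subset[OF neg]) (unfold frontier_def, blast)
    qed
    with D'(3) show "measure lebesgue E - e < measure lebesgue (E \<inter> interior (\<Union>D))"
      using \<open>measure lebesgue (\<Union>((\<lambda>i. E \<inter> ?B i) ` C)) = measure lebesgue E\<close> by simp
  qed
qed

text \<open>At these points the upper derivative, taken over shrinking intervals around the point, is at least
\<open>q\<close>. Requiring the point in the open interval makes this set a countable intersection of
open sets, hence Borel. The lower derivative is
covered by passing to \<open>- F\<close> and \<open>- q\<close>.\<close>

definition steep :: "(real \<Rightarrow> real) \<Rightarrow> real \<Rightarrow> real set" where
  "steep F q = {x. \<forall>d>0. \<exists>u v. u < x \<and> x < v \<and> v - u < d \<and> q * (v - u) < F v - F u}"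

lemma steep_borel: "steep F q \<in> sets borel"
proof -
  let ?A = "\<lambda>n::nat. \<Union>{{u<..<v} | u v. v - u < inverse (real (Suc n)) \<and> q * (v - u) < F v - F u}"
  have "steep F q = (\<Inter>n. ?A n)"
  proof (intro set_eqI iffI)
    fix x assume "x \<in> steep F q"
    have "x \<in> ?A n" for n
    proof -
      have "0 < inverse (real (Suc n))" by simp
      then obtain u v where "u < x" "x < v" "v - u < inverse (real (Suc n))" "q * (v - u) < F v - F u"
        using \<open>x \<in> steep F q\<close> unfolding steep_def by blast
      then show ?thesis by (intro UnionI[of "{u<..<v}"] CollectI exI[of _ u] exI[of _ v]) auto
    qed
    then show "x \<in> (\<Inter>n. ?A n)" by blast
  next
    fix x assume x: "x \<in> (\<Inter>n. ?A n)"
    show "x \<in> steep F q"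
      unfolding steep_def
    proof (intro CollectI allI impI)
      fix d :: real assume "0 < d"
      then obtain n where n: "inverse (real (Suc n)) < d" using reals_Archimedean by blast
      have "x \<in> ?A n" using x by blast
      then obtain u v where "x \<in> {u<..<v}" "v - u < inverse (real (Suc n))" "q * (v - u) < F v - F u"
        by blast
      with n show "\<exists>u v. u < x \<and> x < v \<and> v - u < d \<and> q * (v - u) < F v - F u"
        by (intro exI[of _ u] exI[of _ v]) auto
    qed
  qed
  moreover have "open (?A n)" for n by (intro open_Union) auto
  ultimately show ?thesis by auto
qed

text \<open>Let \<open>E\<close> be the set in question. Up to small errors, \<open>E\<close> is filled by intervals \<open>I\<close> on which \<open>F\<close> grows
at a rate below \<open>p\<close>, and once more by intervals \<open>J\<close>, chosen inside the first family, on which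
\<open>F\<close> grows at a rate above \<open>q\<close>. Both unions have almost the measure of \<open>E\<close>, so the gaps left in \<open>I\<close> by \<open>J\<close> have
small total length, and by absolute continuity \<open>F\<close> changes little over them. Hence the total
increments over \<open>I\<close> and \<open>J\<close> nearly agree, which forces the measure of \<open>E\<close> to be zero.\<close>

lemma negligible_steep_both:
  assumes F: "ac_on a b F" and "p < q"
  shows "negligible ({a<..<b} \<inter> steep F q \<inter> steep (\<lambda>x. - F x) (- p))"
proof -
  define E where "E = {a<..<b} \<inter> steep F q \<inter> steep (\<lambda>x. - F x) (- p)"
  have "E \<in> sets borel" unfolding E_def using steep_borel by (simp add: sets.Int)
  then have E: "E \<in> lmeasurable"
    by (intro bounded_set_imp_lmeasurable bounded_subset[OF bounded_box[of a b]])
      (auto simp: E_def sets_completionI_sets)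
  have "measure lebesgue E \<le> 0"
  proof (rule ccontr)
    assume "\<not> measure lebesgue E \<le> 0"
    then have m: "0 < measure lebesgue E" and "a < b" 
      by (simp, cases "a < b") (auto simp: E_def)
    let ?m = "measure lebesgue"
    \<comment> \<open>\<open>g\<close> is the discrepancy between the two rates over \<open>E\<close>; the errors, governed by \<open>e\<close>,
      are made to add up to less than \<open>g\<close>.\<close>
    define g where "g = (q - p) * ?m E"
    have "0 < g" using m \<open>p < q\<close> by (simp add: g_def)
    then have "0 < g / 4" by simp
    obtain d where d: "0 < d" "\<And>D. \<lbrakk>D division_of \<Union>D; \<Union>D \<subseteq> {a..b}; ?m (\<Union>D) < d\<rbrakk>
      \<Longrightarrow> (\<Sum>K\<in>D. norm (F (Sup K) - F (Inf K))) < g / 4"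
      using ac_onE[OF F \<open>0 < g / 4\<close>] by blast
    define e where "e = min d (min (g / (4 * (\<bar>p\<bar> + 1))) (g / (4 * (q - p)))) / 4"
    have "0 < e" using d \<open>0 < g\<close> \<open>p < q\<close> by (auto simp: e_def)
    have ed: "4 * e \<le> d" by (simp add: e_def)
    have "4 * e \<le> g / (4 * (\<bar>p\<bar> + 1))" by (simp add: e_def)
    then have ep: "16 * e * (\<bar>p\<bar> + 1) \<le> g" by (simp add: field_simps)
    have "4 * e \<le> g / (4 * (q - p))" by (simp add: e_def)
    then have eq: "16 * e * (q - p) \<le> g" using \<open>p < q\<close> by (simp add: field_simps)
    obtain T where T: "open T" "E \<subseteq> T" "T \<in> lmeasurable" "?m T < ?m E + e"
      using lmeasurable_open_superset[OF E \<open>0 < e\<close>] .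
    have Tab: "open (T \<inter> {a<..<b})" "E \<subseteq> T \<inter> {a<..<b}" using T by (auto simp: E_def)
    have "\<exists>u v. u < x \<and> x < v \<and> v - u < d \<and> F v - F u < p * (v - u)" if "x \<in> E" "0 < d" for x d
    proof -
      have "x \<in> steep (\<lambda>x. - F x) (- p)" using that by (simp add: E_def)
      with \<open>0 < d\<close> obtain u v where "u < x" "x < v" "v - u < d" "- p * (v - u) < - F v - - F u"
        unfolding steep_def by blast
      then show ?thesis by (intro exI[of _ u] exI[of _ v]) (auto simp: algebra_simps)
    qed
    then obtain I where I: "I division_of \<Union>I" "\<Union>I \<subseteq> T \<inter> {a<..<b}"
      "\<And>K. K \<in> I \<Longrightarrow> F (Sup K) - F (Inf K) < p * (Sup K - Inf K)" "?m E - e < ?m (E \<inter> interior (\<Union>I))"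
      using vitali_finite_division[OF E Tab \<open>0 < e\<close>, where P = "\<lambda>u v. F v - F u < p * (v - u)"] by metis
    define E1 where "E1 = E \<inter> interior (\<Union>I)"
    have E1: "E1 \<in> lmeasurable" unfolding E1_def
      using E by (intro fmeasurable_Int_fmeasurable) auto
    have "\<exists>u v. u < x \<and> x < v \<and> v - u < d \<and> q * (v - u) < F v - F u" if "x \<in> E1" "0 < d" for x d
      using that by (auto simp: E1_def E_def steep_def)
    then obtain J where J: "J division_of \<Union>J" "\<Union>J \<subseteq> interior (\<Union>I)"
      "\<And>K. K \<in> J \<Longrightarrow> q * (Sup K - Inf K) < F (Sup K) - F (Inf K)" "?m E1 - e < ?m (E1 \<inter> interior (\<Union>J))"
      using vitali_finite_division[OF E1 open_interior _ \<open>0 < e\<close>, where P = "\<lambda>u v. q * (v - u) < F v - F u"]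
      by (metis E1_def inf_le2)
    have JI: "\<Union>J \<subseteq> \<Union>I" using J(2) interior_subset by blast
    obtain R where R: "J \<subseteq> R" "R division_of \<Union>I"
      using partial_division_extend[OF J(1) I(1) JI] by metis
    let ?F = "\<lambda>K. F (Sup K) - F (Inf K)"
    have len: "(\<Sum>K\<in>D. Sup K - Inf K) = ?m (\<Union>D)" if D: "D division_of \<Union>D" for D :: "real set set"
    proof -
      have "Sup K - Inf K = ?m K" if "K \<in> D" for K
        by (rule division_element_real[OF D that]) simp
      then show ?thesis using content_division[OF D] by simp
    qed
    have divR: "R division_of \<Union>R" using R(2) by (metis division_ofD(6))
    have RJ: "(R - J) division_of \<Union>(R - J)"
      using division_of_subset[OF divR, of "R - J"] by blast
    have fin: "\<Union>D \<in> lmeasurable" if "D division_of \<Union>D" for D :: "real set set"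
      using that lmeasurable_division by blast
    \<comment> \<open>\<open>I\<close> exceeds \<open>E\<close> by at most \<open>e\<close>, and \<open>J\<close> misses at most \<open>2 * e\<close> of it.\<close>
    have mI: "?m (\<Union>I) < ?m E + e"
    proof -
      have "?m (\<Union>I) \<le> ?m T" using I(2) T fin[OF I(1)] by (intro measure_mono_fmeasurable) auto
      then show ?thesis using T by simp
    qed
    have mJ: "?m E - 2 * e < ?m (\<Union>J)"
    proof -
      have "?m (E1 \<inter> interior (\<Union>J)) \<le> ?m (\<Union>J)"
        using interior_subset fin[OF J(1)] E1 by (intro measure_mono_fmeasurable) (auto intro!: sets.Int)
      then show ?thesis using J(4) I(4) by (simp add: E1_def)
    qed
    have lenR: "(\<Sum>K\<in>R. Sup K - Inf K) = ?m (\<Union>I)"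
      using len[OF divR] R(2) by (metis division_ofD(6))
    have finR: "finite R" using R by blast
    have splitR: "sum w R = sum w (R - J) + sum w J" for w :: "real set \<Rightarrow> real"
      using sum.subset_diff[OF R(1) finR] .
    have "?m (\<Union>(R - J)) = ?m (\<Union>I) - ?m (\<Union>J)"
      using splitR[of "\<lambda>K. Sup K - Inf K"] lenR len[OF RJ] len[OF J(1)] by simp
    then have gap: "?m (\<Union>(R - J)) < 4 * e" using mI mJ \<open>0 < e\<close> by simp
    have Rab: "\<Union>(R - J) \<subseteq> {a..b}"
    proof -
      have "\<Union>(R - J) \<subseteq> \<Union>I" using division_ofD(6)[OF R(2)] by blast
      also have "\<Union>I \<subseteq> {a<..<b}" using I(2) by blast
      also have "{a<..<b} \<subseteq> {a..b}" by auto
      finally show ?thesis .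
    qed
    have "(\<Sum>K\<in>R - J. norm (?F K)) < g / 4"
      by (rule d(2)[OF RJ Rab]) (use gap ed in simp)
    then have small: "norm (sum ?F (R - J)) < g / 4"
      by (rule le_less_trans[OF norm_sum])
    have "q * ?m (\<Union>J) \<le> sum ?F J"
      unfolding len[OF J(1), symmetric] sum_distrib_left using J(3) by (intro sum_mono) (simp add: less_imp_le)
    moreover have "sum ?F I \<le> p * ?m (\<Union>I)"
      unfolding len[OF I(1), symmetric] sum_distrib_left using I(3) by (intro sum_mono) (simp add: less_imp_le)
    moreover have "sum ?F R = sum ?F I"
    proof (rule sum_increments_same_union[OF R(2) I(1)])
      have "{a<..<b} \<subseteq> {a..b}" by auto
      then show "\<Union>I \<subseteq> {a..b}" using I(2) by blast
    qed (use \<open>a < b\<close> in simp)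
    ultimately have "q * ?m (\<Union>J) < p * ?m (\<Union>I) + g / 4"
      using small splitR[of ?F] by simp
    then have "(q - p) * ?m (\<Union>J) < p * (?m (\<Union>I) - ?m (\<Union>J)) + g / 4"
      by (simp add: algebra_simps)
    also have "p * (?m (\<Union>I) - ?m (\<Union>J)) \<le> \<bar>p\<bar> * (4 * e)"
    proof -
      have "0 \<le> ?m (\<Union>I) - ?m (\<Union>J)"
        using measure_mono_fmeasurable[OF JI _ fin[OF I(1)]] fin[OF J(1)] by auto
      moreover have "?m (\<Union>I) - ?m (\<Union>J) \<le> 4 * e" using mI mJ \<open>0 < e\<close> by simp
      ultimately show ?thesis
        by (metis abs_ge_self abs_ge_zero mult_mono)
    qed
    also have "\<bar>p\<bar> * (4 * e) \<le> g / 4"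
      using ep \<open>0 < e\<close> by (simp add: algebra_simps)
    finally have "(q - p) * ?m (\<Union>J) < g / 2" by simp
    moreover have "(q - p) * (?m E - 2 * e) \<le> (q - p) * ?m (\<Union>J)"
      using mJ \<open>p < q\<close> by (intro mult_left_mono) auto
    ultimately have "g - 2 * e * (q - p) < g / 2"
      by (simp add: g_def algebra_simps)
    with eq \<open>0 < g\<close> show False by simp
  qed
  then show ?thesis
    using E by (metis E_def measure_le_0_iff negligible_iff_measure)
qed

section \<open>Differentiation of absolutely continuous functions\<close>

text \<open>On a piece of length less than the \<open>d\<close> that belongs to the variation bound \<open>1\<close>, intervals on which
\<open>F\<close> grows at rate \<open>n\<close> have total length at most \<open>1 / n\<close>. If the set had positive measure there,
Vitali families would keep this length bounded below for every \<open>n\<close>.\<close>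

lemma negligible_steep_unbounded:
  assumes F: "ac_on a b F"
  shows "negligible ({a<..<b} \<inter> (\<Inter>n::nat. steep F (real n)))"
proof -
  define E where "E = {a<..<b} \<inter> (\<Inter>n::nat. steep F (real n))"
  have Eb: "E \<in> sets borel" unfolding E_def using steep_borel by (simp add: sets.Int sets.countable_INT')
  have "(0::real) < 1" by simp
  obtain d where d: "0 < d" "\<And>D. \<lbrakk>D division_of \<Union>D; \<Union>D \<subseteq> {a..b}; measure lebesgue (\<Union>D) < d\<rbrakk>
      \<Longrightarrow> (\<Sum>K\<in>D. norm (F (Sup K) - F (Inf K))) < 1"
    using ac_onE[OF F \<open>0 < 1\<close>] by blast
  have "negligible (E \<inter> {x - d/4<..<x + d/4})" for x
  proof -
    let ?W = "{x - d/4<..<x + d/4}"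
    let ?m = "measure lebesgue"
    have U: "E \<inter> ?W \<in> lmeasurable"
      using Eb by (intro bounded_set_imp_lmeasurable bounded_subset[OF bounded_box[of "x - d/4" "x + d/4"]])
        (auto simp: sets_completionI_sets)
    have "?m (E \<inter> ?W) \<le> 0"
    proof (rule ccontr)
      assume "\<not> ?m (E \<inter> ?W) \<le> 0"
      then have m: "0 < ?m (E \<inter> ?W) / 2" by simp
      then obtain n :: nat where n: "1 < real n * (?m (E \<inter> ?W) / 2)"
        using reals_Archimedean3 by blast
      have W: "open (?W \<inter> {a<..<b})" "E \<inter> ?W \<subseteq> ?W \<inter> {a<..<b}" by (auto simp: E_def)
      have "\<exists>u v. u < y \<and> y < v \<and> v - u < e \<and> real n * (v - u) < F v - F u" if "y \<in> E \<inter> ?W" "0 < e" for y e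
      proof -
        have "y \<in> steep F (real n)" using that(1) by (auto simp: E_def)
        with that(2) show ?thesis by (simp add: steep_def)
      qed
      then obtain J where J: "J division_of \<Union>J" "\<Union>J \<subseteq> ?W \<inter> {a<..<b}"
        "\<And>K. K \<in> J \<Longrightarrow> real n * (Sup K - Inf K) < F (Sup K) - F (Inf K)"
        "?m (E \<inter> ?W) - ?m (E \<inter> ?W) / 2 < ?m ((E \<inter> ?W) \<inter> interior (\<Union>J))"
        using vitali_finite_division[OF U W m, where P = "\<lambda>u v. real n * (v - u) < F v - F u"] by metis
      have Jm: "\<Union>J \<in> lmeasurable" using J(1) lmeasurable_division by blast
      have "?m (\<Union>J) \<le> ?m ?W" using J(2) Jm by (intro measure_mono_fmeasurable) auto
      then have "?m (\<Union>J) < d" using d(1) by simp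
      moreover have "\<Union>J \<subseteq> {a..b}"
      proof -
        have "\<Union>J \<subseteq> {a<..<b}" using J(2) by blast
        also have "{a<..<b} \<subseteq> {a..b}" by auto
        finally show ?thesis .
      qed
      ultimately have "(\<Sum>K\<in>J. norm (F (Sup K) - F (Inf K))) < 1" using d(2)[OF J(1)] by blast
      moreover have "real n * ?m (\<Union>J) \<le> (\<Sum>K\<in>J. norm (F (Sup K) - F (Inf K)))"
      proof -
        have "real n * ?m K \<le> norm (F (Sup K) - F (Inf K))" if "K \<in> J" for K
          by (rule division_element_real[OF J(1) that]) (use J(3)[OF that] in auto)
        then show ?thesis
          unfolding content_division[OF J(1), symmetric] sum_distrib_left by (intro sum_mono)
      qed
      moreover have "?m ((E \<inter> ?W) \<inter> interior (\<Union>J)) \<le> ?m (\<Union>J)"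
        using interior_subset[of "\<Union>J"]
        by (intro measure_mono_fmeasurable Jm sets.Int[OF fmeasurableD[OF U]]) auto
      with J(4) have "real n * (?m (E \<inter> ?W) / 2) \<le> real n * ?m (\<Union>J)"
        by (intro mult_left_mono) auto
      ultimately show False using n by simp
    qed
    then show ?thesis using U by (metis measure_le_0_iff negligible_iff_measure)
  qed
  then have "negligible E"
    unfolding locally_negligible_alt[of E]
  proof (intro ballI)
    fix x assume "x \<in> E" and neg: "\<And>x. negligible (E \<inter> {x - d/4<..<x + d/4})"
    then show "\<exists>U. openin (top_of_set E) U \<and> x \<in> U \<and> negligible U"
      using d(1) by (intro exI[of _ "E \<inter> {x - d/4<..<x + d/4}"] conjI openin_open_Int) auto
  qed
  then show ?thesis by (simp add: E_def)
qed

lemma steep_antimono: "p \<le> q \<Longrightarrow> steep F q \<subseteq> steep F p"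
proof
  fix x assume "p \<le> q" and x: "x \<in> steep F q"
  show "x \<in> steep F p"
    unfolding steep_def
  proof (intro CollectI allI impI)
    fix d :: real assume "0 < d"
    then obtain u v where uv: "u < x" "x < v" "v - u < d" "q * (v - u) < F v - F u"
      using x unfolding steep_def by blast
    have "p * (v - u) \<le> q * (v - u)"
      using \<open>p \<le> q\<close> uv by (intro mult_right_mono) auto
    with uv(4) have "p * (v - u) < F v - F u" by linarith
    with uv show "\<exists>u v. u < x \<and> x < v \<and> v - u < d \<and> p * (v - u) < F v - F u"
      by blast
  qed
qed

lemma not_steepE:
  assumes "x \<notin> steep F q"
  obtains d where "0 < d" "\<And>u v. \<lbrakk>u < x; x < v; v - u < d\<rbrakk> \<Longrightarrow> F v - F u \<le> q * (v - u)"
proof -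
  obtain d where "0 < d" and d: "\<not> (\<exists>u v. u < x \<and> x < v \<and> v - u < d \<and> q * (v - u) < F v - F u)"
    using assms unfolding steep_def by blast
  have "F v - F u \<le> q * (v - u)" if "u < x" "x < v" "v - u < d" for u v
  proof (rule ccontr)
    assume "\<not> F v - F u \<le> q * (v - u)"
    then have "q * (v - u) < F v - F u" by (rule not_le_imp_less)
    with that d show False by blast
  qed
  then show thesis using that \<open>0 < d\<close> by blast
qed

text \<open>Outside the exceptional sets the upper and lower derivatives are finite and no pair of rationals
separates them, so they have a common value \<open>L\<close>. Increments over intervals around \<open>x\<close> are then
controlled by \<open>L\<close>, and continuity lets one end of the interval move to \<open>x\<close> itself.\<close>

lemma ac_on_real_differentiable_ae:
  fixes F :: "real \<Rightarrow> real"
  assumes F: "ac_on a b F"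
  obtains N where "negligible N" "\<And>x. x \<in> {a<..<b} - N \<Longrightarrow> F differentiable (at x)"
proof -
  let ?G = "\<lambda>x. - F x"
  have G: "ac_on a b ?G"
    by (rule ac_on_contraction[OF F]) simp
  define A where "A = ({a<..<b} \<inter> (\<Inter>n::nat. steep F (real n)))"
  define B where "B = ({a<..<b} \<inter> (\<Inter>n::nat. steep ?G (real n)))"
  define I where "I = {(p, q). p \<in> \<rat> \<and> q \<in> \<rat> \<and> p < (q::real)}"
  define C where "C = (\<Union>(p, q)\<in>I. {a<..<b} \<inter> steep F q \<inter> steep ?G (- p))"
  have "countable I"
    by (rule countable_subset[of _ "\<rat> \<times> \<rat>"]) (auto simp: I_def countable_rat)
  have "negligible C"
    unfolding C_def
  proof (rule negligible_countable_Union)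
    show "countable ((\<lambda>(p, q). {a<..<b} \<inter> steep F q \<inter> steep ?G (- p)) ` I)"
      using \<open>countable I\<close> by simp
    fix T assume "T \<in> (\<lambda>(p, q). {a<..<b} \<inter> steep F q \<inter> steep ?G (- p)) ` I"
    then obtain p q where "p < q" "T = {a<..<b} \<inter> steep F q \<inter> steep ?G (- p)"
      by (auto simp: I_def)
    then show "negligible T" using negligible_steep_both[OF F] by simp
  qed
  moreover have "negligible A" "negligible B"
    unfolding A_def B_def using negligible_steep_unbounded[OF F] negligible_steep_unbounded[OF G] by auto
  ultimately have neg: "negligible (A \<union> B \<union> C)" by (intro negligible_Un)
  show thesis
  proof (rule that[OF neg])
    fix x assume x: "x \<in> {a<..<b} - (A \<union> B \<union> C)"
    obtain n1 :: nat where n1: "x \<notin> steep F (real n1)" using x by (auto simp: A_def)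
    obtain n2 :: nat where n2: "x \<notin> steep ?G (real n2)" using x by (auto simp: B_def)
    define Q where "Q = {q. x \<in> steep F q}"
    define L where "L = Sup Q"
    have bdd: "bdd_above Q"
    proof (rule bdd_aboveI[of _ "real n1"])
      fix q assume "q \<in> Q"
      then show "q \<le> real n1" using steep_antimono[of "real n1" q F] n1 by (force simp: Q_def)
    qed
    have "- real n2 - 1 \<in> Q"
      unfolding Q_def steep_def
    proof (intro CollectI allI impI)
      fix d :: real assume "0 < d"
      obtain e where e: "0 < e" "\<And>u v. \<lbrakk>u < x; x < v; v - u < e\<rbrakk> \<Longrightarrow> - F v - - F u \<le> real n2 * (v - u)"
        using not_steepE[OF n2] by blast
      define h where "h = min d e / 4"
      have h: "0 < h" "2 * h < d" "2 * h < e" using \<open>0 < d\<close> \<open>0 < e\<close> by (auto simp: h_def)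
      have "F (x - h) - F (x + h) \<le> real n2 * (2 * h)"
        using e(2)[of "x - h" "x + h"] h by simp
      then have "(- real n2 - 1) * (2 * h) < F (x + h) - F (x - h)"
        using h(1) by (simp add: algebra_simps)
      with h show "\<exists>u v. u < x \<and> x < v \<and> v - u < d \<and> (- real n2 - 1) * (v - u) < F v - F u"
        by (intro exI[of _ "x - h"] exI[of _ "x + h"]) simp
    qed
    then have ne: "Q \<noteq> {}" by blast
    have upper: "x \<notin> steep F (L + e)" if "0 < e" for e
    proof
      assume "x \<in> steep F (L + e)"
      then have "L + e \<le> L" unfolding L_def Q_def[symmetric] by (intro cSup_upper bdd) (simp add: Q_def)
      with that show False by simp
    qed
    have lower: "x \<notin> steep ?G (- (L - e))" if "0 < e" for e
    proof -
      obtain q0 where q0: "q0 \<in> Q" "L - e < q0"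
        using less_cSupD[OF ne, of "L - e"] \<open>0 < e\<close> by (auto simp: L_def)
      obtain q where q: "q \<in> \<rat>" "L - e < q" "q < q0" using Rats_dense_in_real[OF q0(2)] by blast
      obtain p where p: "p \<in> \<rat>" "L - e < p" "p < q" using Rats_dense_in_real[OF q(2)] by blast
      have "x \<in> steep F q" using steep_antimono[of q q0 F] q q0 by (auto simp: Q_def)
      then have "x \<notin> steep ?G (- p)" using x p q by (force simp: C_def I_def)
      then show ?thesis using steep_antimono[of "- p" "- (L - e)" ?G] p by auto
    qed
    have cont: "isCont F x"
      using continuous_on_interior[OF ac_on_continuous[OF F], of x] x by simp
    have "(F has_derivative (\<lambda>h. L * h)) (at x)"
      unfolding has_derivative_at_alt
    proof (intro conjI allI impI bounded_linear_mult_right)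
      fix e :: real assume "0 < e"
      obtain d1 where d1: "0 < d1" "\<And>u v. \<lbrakk>u < x; x < v; v - u < d1\<rbrakk> \<Longrightarrow> F v - F u \<le> (L + e) * (v - u)"
        using not_steepE[OF upper[OF \<open>0 < e\<close>]] by blast
      obtain d2 where d2: "0 < d2" "\<And>u v. \<lbrakk>u < x; x < v; v - u < d2\<rbrakk> \<Longrightarrow> - F v - - F u \<le> - (L - e) * (v - u)"
        using not_steepE[OF lower[OF \<open>0 < e\<close>]] by blast
      define d where "d = min d1 d2"
      have "0 < d" using d1(1) d2(1) by (simp add: d_def)
      have two: "\<bar>F v - F u - L * (v - u)\<bar> \<le> e * (v - u)"
        if "u < x" "x < v" "v - u < d" for u v
        using d1(2)[of u v] d2(2)[of u v] that by (simp add: d_def algebra_simps abs_le_iff)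
      show "\<exists>d>0. \<forall>y. norm (y - x) < d \<longrightarrow> norm (F y - F x - L * (y - x)) \<le> e * norm (y - x)"
      proof (intro exI[of _ d] conjI allI impI)
        fix y assume y: "norm (y - x) < d"
        consider "y = x" | "x < y" | "y < x" by linarith
        then show "norm (F y - F x - L * (y - x)) \<le> e * norm (y - x)"
        proof cases
          case 2
          have "((\<lambda>u. \<bar>F y - F u - L * (y - u)\<bar>) \<longlongrightarrow> \<bar>F y - F x - L * (y - x)\<bar>) (at_left x)"
            using cont by (intro tendsto_intros) (auto simp: isCont_def filterlim_at_split)
          moreover have "((\<lambda>u. e * (y - u)) \<longlongrightarrow> e * (y - x)) (at_left x)"
            by (intro tendsto_intros)
          moreover have "\<forall>\<^sub>F u in at_left x. \<bar>F y - F u - L * (y - u)\<bar> \<le> e * (y - u)"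
            unfolding eventually_at_left_field
            using 2 y two[of _ y] by (intro exI[of _ "y - d"]) auto
          ultimately have "\<bar>F y - F x - L * (y - x)\<bar> \<le> e * (y - x)"
            by (intro tendsto_le[of "at_left x"]) auto
          then show ?thesis using 2 by simp
        next
          case 3
          have "((\<lambda>v. \<bar>F v - F y - L * (v - y)\<bar>) \<longlongrightarrow> \<bar>F x - F y - L * (x - y)\<bar>) (at_right x)"
            using cont by (intro tendsto_intros) (auto simp: isCont_def filterlim_at_split)
          moreover have "((\<lambda>v. e * (v - y)) \<longlongrightarrow> e * (x - y)) (at_right x)"
            by (intro tendsto_intros)
          moreover have "\<forall>\<^sub>F v in at_right x. \<bar>F v - F y - L * (v - y)\<bar> \<le> e * (v - y)"
            unfolding eventually_at_right_field
            using 3 y two[of y] by (intro exI[of _ "y + d"]) auto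
          ultimately have "\<bar>F x - F y - L * (x - y)\<bar> \<le> e * (x - y)"
            by (intro tendsto_le[of "at_right x"]) auto
          moreover have "F y - F x - L * (y - x) = - (F x - F y - L * (x - y))" by (simp add: algebra_simps)
          ultimately show ?thesis using 3 by (simp only: norm_minus_cancel) simp
        qed simp
      qed fact
    qed
    then show "F differentiable (at x)" unfolding differentiable_def by blast
  qed
qed

lemma ac_on_complex_differentiable_ae:
  fixes F :: "real \<Rightarrow> complex"
  assumes F: "ac_on a b F"
  obtains N where "negligible N" "\<And>x. x \<in> {a<..<b} - N \<Longrightarrow> F differentiable (at x)"
proof -
  have "norm (Re (F v) - Re (F u)) \<le> norm (F v - F u)"
    "norm (Im (F v) - Im (F u)) \<le> norm (F v - F u)" for u v
    using abs_Re_le_cmod[of "F v - F u"] abs_Im_le_cmod[of "F v - F u"] by simp_all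
  then have "ac_on a b (\<lambda>x. Re (F x))" "ac_on a b (\<lambda>x. Im (F x))"
    by (blast intro: ac_on_contraction[OF F])+
  then obtain N1 N2 where N: "negligible N1" "\<And>x. x \<in> {a<..<b} - N1 \<Longrightarrow> (\<lambda>x. Re (F x)) differentiable (at x)"
     "negligible N2" "\<And>x. x \<in> {a<..<b} - N2 \<Longrightarrow> (\<lambda>x. Im (F x)) differentiable (at x)"
    using ac_on_real_differentiable_ae by metis
  show thesis
  proof (rule that[of "N1 \<union> N2"])
    show "negligible (N1 \<union> N2)" using N by simp
    fix x assume "x \<in> {a<..<b} - (N1 \<union> N2)"
    then obtain A B where "((\<lambda>x. Re (F x)) has_real_derivative A) (at x)" "((\<lambda>x. Im (F x)) has_real_derivative B) (at x)"
      using N by (metis DiffD1 DiffD2 DiffI Un_iff real_differentiable_def)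
    then have "(F has_vector_derivative Complex A B) (at x)"
      by (simp add: has_vector_derivative_complex_iff)
    then show "F differentiable (at x)" by (rule differentiableI_vector)
  qed
qed

text \<open>The gauge integral handles the null set directly: intervals tagged in \<open>N\<close> are confined to an open set
of small measure, so absolute continuity bounds the sum of their increments, while the other
intervals are treated by differentiability, as for a function differentiable everywhere.\<close>

theorem ac_on_fundamental_theorem:
  fixes G :: "real \<Rightarrow> 'a::banach"
  assumes G: "ac_on a b G" and "a \<le> b" and N: "negligible N"
    and deriv: "\<And>x. x \<in> {a..b} - N \<Longrightarrow> (G has_vector_derivative g x) (at x within {a..b})"
  shows "(g has_integral G b - G a) {a..b}"
proof -
  let ?g = "\<lambda>x. if x \<in> N then 0 else g x"
  have "(?g has_integral G b - G a) {a..b}"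
    unfolding has_integral_real
  proof (intro allI impI)
    fix e :: real assume "0 < e"
    then have "0 < e / 2" by simp
    obtain \<delta> where \<delta>: "0 < \<delta>" "\<And>D. \<lbrakk>D division_of \<Union>D; \<Union>D \<subseteq> {a..b}; measure lebesgue (\<Union>D) < \<delta>\<rbrakk>
      \<Longrightarrow> (\<Sum>K\<in>D. norm (G (Sup K) - G (Inf K))) < e / 2"
      using ac_onE[OF G \<open>0 < e / 2\<close>] by blast
    obtain T where T: "open T" "N \<subseteq> T" "T \<in> lmeasurable" "measure lebesgue T < \<delta>"
      using lmeasurable_open_superset[of N \<delta>] N \<delta>(1) negligible_imp_measurable negligible_imp_measure0
      by (metis add_0)
    define c where "c = e / 2 / (b - a + 1)"
    have c: "0 < c" "c * (b - a) < e / 2"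
      using \<open>0 < e\<close> \<open>a \<le> b\<close> by (auto simp: c_def field_simps)
    have "\<exists>d>0. ball x d \<subseteq> T" if "x \<in> N" for x
      using T that by (meson openE subsetD)
    then obtain r where r: "\<And>x. x \<in> N \<Longrightarrow> 0 < r x \<and> ball x (r x) \<subseteq> T" by metis
    have "\<exists>d>0. \<forall>y\<in>{a..b}. norm (y - x) < d \<longrightarrow>
        norm (G y - G x - (y - x) *\<^sub>R g x) \<le> c * norm (y - x)" if "x \<in> {a..b} - N" for x
      using deriv[OF that] c(1) unfolding has_vector_derivative_def has_derivative_within_alt by blast
    then obtain s where s: "\<And>x. x \<in> {a..b} - N \<Longrightarrow> 0 < s x"
      "\<And>x y. \<lbrakk>x \<in> {a..b} - N; y \<in> {a..b}; norm (y - x) < s x\<rbrakk>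
        \<Longrightarrow> norm (G y - G x - (y - x) *\<^sub>R g x) \<le> c * norm (y - x)" by metis
    define d where "d x = (if x \<in> N then r x else if x \<in> {a..b} then s x else 1)" for x
    have d: "0 < d x" for x using r s(1) by (simp add: d_def)
    show "\<exists>\<gamma>. gauge \<gamma> \<and> (\<forall>p. p tagged_division_of {a..b} \<and> \<gamma> fine p \<longrightarrow>
        norm ((\<Sum>(x, K)\<in>p. measure lborel K *\<^sub>R ?g x) - (G b - G a)) < e)"
    proof (intro exI conjI allI impI)
      show "gauge (\<lambda>x. ball x (d x))" using d gauge_ball_dependent by blast
      fix p assume "p tagged_division_of {a..b} \<and> (\<lambda>x. ball x (d x)) fine p"
      then have p: "p tagged_division_of {a..b}" and fine: "(\<lambda>x. ball x (d x)) fine p" by auto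
      let ?\<Delta> = "\<lambda>K. G (Sup K) - G (Inf K)"
      define pN where "pN = {t \<in> p. fst t \<in> N}"
      have pfin: "finite p" using p by blast
      have el: "\<exists>u v. u \<le> v \<and> K = {u..v} \<and> x \<in> K \<and> K \<subseteq> {a..b} \<and> K \<subseteq> ball x (d x)" if "(x, K) \<in> p" for x K
      proof -
        obtain u v where "K = cbox u v" using tagged_division_ofD(4)[OF p \<open>(x, K) \<in> p\<close>] by blast
        moreover have "x \<in> K" "K \<subseteq> {a..b}" using tagged_division_ofD(2,3)[OF p that] .
        moreover have "K \<subseteq> ball x (d x)" using fineD[OF fine that] .
        ultimately show ?thesis by (intro exI[of _ u] exI[of _ v]) auto
      qed
      have part: "pN tagged_partial_division_of {a..b}"
        using p tagged_partial_division_subset[of p "{a..b}" pN] by (auto simp: pN_def tagged_division_of_def)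
      then have div: "(snd ` pN) division_of \<Union>(snd ` pN)"
        by (rule partial_division_of_tagged_division)
      have "\<Union>(snd ` pN) \<subseteq> T"
      proof clarsimp
        fix y x K assume "(x, K) \<in> pN" "y \<in> K"
        then show "y \<in> T" using el[of x K] r[of x] by (auto simp: pN_def d_def)
      qed
      then have "measure lebesgue (\<Union>(snd ` pN)) \<le> measure lebesgue T"
        using lmeasurable_division[OF div] T by (intro measure_mono_fmeasurable) auto
      moreover have "\<Union>(snd ` pN) \<subseteq> {a..b}" using el by (force simp: pN_def)
      ultimately have "(\<Sum>K\<in>snd ` pN. norm (?\<Delta> K)) < e / 2"
        using \<delta>(2)[OF div] T(4) by simp
      also have "(\<Sum>K\<in>snd ` pN. norm (?\<Delta> K)) = (\<Sum>t\<in>pN. norm (?\<Delta> (snd t)))"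
      proof (subst sum.reindex_nontrivial)
        show "finite pN" using pfin by (simp add: pN_def)
        fix t t' assume tt: "t \<in> pN" "t' \<in> pN" "t \<noteq> t'" "snd t = snd t'"
        have tp: "(fst t, snd t) \<in> p" "(fst t', snd t') \<in> p" using tt(1,2) by (auto simp: pN_def)
        have "interior (snd t) \<inter> interior (snd t') = {}"
          using tagged_division_ofD(5)[OF p tp] tt(3) by (simp add: prod_eq_iff)
        moreover obtain u v where "u \<le> v" "snd t = {u..v}" using el[OF tp(1)] by blast
        ultimately show "norm (?\<Delta> (snd t)) = 0" using tt(4) by simp
      qed (simp add: o_def)
      finally have N_part: "(\<Sum>t\<in>pN. norm (?\<Delta> (snd t))) < e / 2" .
      have good: "norm (measure lborel K *\<^sub>R g x - ?\<Delta> K) \<le> c * (Sup K - Inf K)" if "(x, K) \<in> p" "x \<notin> N" for x K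
      proof -
        obtain u v where K: "u \<le> v" "K = {u..v}" "x \<in> K" "K \<subseteq> {a..b}" "K \<subseteq> ball x (d x)"
          using el[OF \<open>(x, K) \<in> p\<close>] by blast
        have x: "x \<in> {a..b} - N" using K that by blast
        have sx: "d x = s x" using x by (simp add: d_def)
        have "u \<in> K" "v \<in> K" using K by auto
        then have "u \<in> ball x (s x)" "v \<in> ball x (s x)" using K(5) sx by auto
        then have uv: "norm (u - x) < s x" "norm (v - x) < s x"
          by (auto simp: dist_real_def)
        have "norm ((v - u) *\<^sub>R g x - (G v - G u))
            = norm ((G u - G x - (u - x) *\<^sub>R g x) - (G v - G x - (v - x) *\<^sub>R g x))"
          by (rule arg_cong[where f = norm]) (simp add: algebra_simps)
        also have "\<dots> \<le> norm (G u - G x - (u - x) *\<^sub>R g x) + norm (G v - G x - (v - x) *\<^sub>R g x)"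
          by (rule norm_triangle_ineq4)
        also have "\<dots> \<le> c * norm (u - x) + c * norm (v - x)"
          using s(2)[OF x _ uv(1)] s(2)[OF x _ uv(2)] \<open>u \<in> K\<close> \<open>v \<in> K\<close> K(4) by (intro add_mono) auto
        also have "\<dots> = c * (v - u)" using K by (simp add: algebra_simps)
        finally show ?thesis using K by simp
      qed
      have inc: "b - a = (\<Sum>(x, K)\<in>p. Sup K - Inf K)" "G b - G a = (\<Sum>(x, K)\<in>p. ?\<Delta> K)"
        using additive_tagged_division_1[OF \<open>a \<le> b\<close> p, of "\<lambda>x. x"]
          additive_tagged_division_1[OF \<open>a \<le> b\<close> p, of G] by auto
      have "norm ((\<Sum>(x, K)\<in>p. measure lborel K *\<^sub>R ?g x) - (G b - G a))
          = norm (\<Sum>t\<in>p. measure lborel (snd t) *\<^sub>R ?g (fst t) - ?\<Delta> (snd t))"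
        unfolding inc(2) by (simp add: split_def sum_subtractf)
      also have "\<dots> \<le> (\<Sum>t\<in>p. norm (measure lborel (snd t) *\<^sub>R ?g (fst t) - ?\<Delta> (snd t)))"
        by (rule norm_sum)
      also have "\<dots> \<le> (\<Sum>t\<in>p. c * (Sup (snd t) - Inf (snd t)) + (if t \<in> pN then norm (?\<Delta> (snd t)) else 0))"
      proof (rule sum_mono)
        fix t assume t: "t \<in> p"
        obtain x K where tt: "t = (x, K)" by (cases t)
        obtain u v where K: "u \<le> v" "K = {u..v}" using el t tt by blast
        show "norm (measure lborel (snd t) *\<^sub>R ?g (fst t) - ?\<Delta> (snd t))
          \<le> c * (Sup (snd t) - Inf (snd t)) + (if t \<in> pN then norm (?\<Delta> (snd t)) else 0)"
        proof (cases "x \<in> N")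
          case True
          then show ?thesis using K c(1) t by (simp add: tt pN_def norm_minus_commute)
        next
          case False
          then show ?thesis using good[of x K] t by (simp add: tt pN_def)
        qed
      qed
      also have "\<dots> = c * (b - a) + (\<Sum>t\<in>pN. norm (?\<Delta> (snd t)))"
        unfolding inc(1) sum.distrib using pfin
        by (simp add: sum_distrib_left split_def pN_def sum.If_cases Int_def)
      also have "\<dots> < e" using c(2) N_part by simp
      finally show "norm ((\<Sum>(x, K)\<in>p. measure lborel K *\<^sub>R ?g x) - (G b - G a)) < e" .
    qed
  qed
  then show ?thesis
    by (rule has_integral_spike[OF N, rotated]) auto
qed

section \<open>The differential equations of the spline\<close>

lemma nderiv_0 [simp]: "nderiv 0 f = f" and nderiv_Suc: "nderiv (Suc k) f = (\<lambda>x. vector_derivative (nderiv k f) (at x))"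
  by (simp_all add: nderiv_def)

lemma times_differentiable_onD:
  assumes "times_differentiable_on k f S" "i < k" "x \<in> S"
  shows "(nderiv i f has_vector_derivative nderiv (Suc i) f x) (at x)"
  using assms unfolding times_differentiable_on_def nderiv_Suc
  by (simp add: vector_derivative_works)

lemma knot_cases:
  fixes \<rho> :: "nat \<Rightarrow> real"
  assumes "1 \<le> n"
  shows "r < \<rho> 1 \<or> \<rho> n < r \<or> (\<exists>j\<in>{1..n}. r = \<rho> j) \<or> (\<exists>j\<in>{1..<n}. r \<in> {\<rho> j<..<\<rho> (j + 1)})"
  using assms
proof (induction n rule: dec_induct)
  case base
  then show ?case by force
next
  case (step n)
  consider "\<rho> (Suc n) < r" | "r = \<rho> (Suc n)" | "r < \<rho> (Suc n)" by linarith
  then show ?case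
  proof cases
    case 3
    then show ?thesis using step by (force simp: less_Suc_eq)
  qed (use step in auto)
qed

text \<open>Inside a piece the second derivative is continuous because the differential equation of the piece
demands a third derivative; beyond the last knot, where only two derivatives are demanded, the
equation \<open>R0 \<eta> r = 0\<close> expresses the second derivative by the first.\<close>

lemma S0_regular:
  assumes \<eta>: "\<eta> \<in> S0 n \<rho>" and "1 \<le> n" "0 < \<rho> 1" "0 < \<rho> n" and "0 < r"
  shows "(\<eta> has_vector_derivative nderiv 1 \<eta> r) (at r)"
    and "(nderiv 1 \<eta> has_vector_derivative nderiv 2 \<eta> r) (at r)"
    and "isCont (nderiv 2 \<eta>) r"
proof -
  have "times_differentiable_on 2 \<eta> {r} \<and> isCont (nderiv 2 \<eta>) r"
  proof -
    have open_piece: ?thesis if "times_differentiable_on m \<eta> S" "2 < m" "r \<in> S" for m S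
    proof
      show "times_differentiable_on 2 \<eta> {r}" using that by (auto simp: times_differentiable_on_def)
      show "isCont (nderiv 2 \<eta>) r"
        using times_differentiable_onD[OF that(1,2,3)] has_vector_derivative_continuous by blast
    qed
    consider "r < \<rho> 1" | "\<rho> n < r" | "\<exists>j\<in>{1..n}. r = \<rho> j" | "\<exists>j\<in>{1..<n}. r \<in> {\<rho> j<..<\<rho> (j + 1)}"
      using knot_cases[OF \<open>1 \<le> n\<close>] by blast
    then show ?thesis
    proof cases
      case 1
      then show ?thesis using open_piece[of 3 "{0<..<\<rho> 1}"] \<eta> \<open>0 < r\<close> by (auto simp: S0_def)
    next
      case 2
      have d: "times_differentiable_on 2 \<eta> {\<rho> n<..}" and R: "\<And>r. r \<in> {\<rho> n<..} \<Longrightarrow> R0 \<eta> r = 0"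
        using \<eta> by (auto simp: S0_def)
      have eq: "nderiv 2 \<eta> x = - ((1 / x) *\<^sub>R nderiv 1 \<eta> x)" if "\<rho> n < x" for x
        using R[of x] that \<open>0 < \<rho> n\<close> by (auto simp: R0_def eq_neg_iff_add_eq_0)
      have "isCont (\<lambda>x. - ((1 / x) *\<^sub>R nderiv 1 \<eta> x)) r"
        using times_differentiable_onD[OF d, of 1 r] 2 \<open>0 < r\<close>
        by (intro continuous_intros) (auto dest: has_vector_derivative_continuous)
      moreover have "\<forall>\<^sub>F x in nhds r. nderiv 2 \<eta> x = - ((1 / x) *\<^sub>R nderiv 1 \<eta> x)"
        using eventually_nhds_in_open[of "{\<rho> n<..}" r] 2 eq by (auto elim: eventually_mono)
      ultimately have "isCont (nderiv 2 \<eta>) r" by (simp add: isCont_cong)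
      then show ?thesis using d 2 by (auto simp: times_differentiable_on_def)
    next
      case 3
      then have "C2_at \<eta> r" using \<eta> by (auto simp: S0_def)
      then show ?thesis unfolding C2_at_def using eventually_nhds_x_imp_x by blast
    next
      case 4
      then obtain j where "j \<in> {1..<n}" "r \<in> {\<rho> j<..<\<rho> (j + 1)}" by blast
      then show ?thesis using open_piece[of 4 "{\<rho> j<..<\<rho> (j + 1)}"] \<eta> by (simp add: S0_def)
    qed
  qed
  then have d: "times_differentiable_on 2 \<eta> {r}" and c: "isCont (nderiv 2 \<eta>) r" by auto
  show "(\<eta> has_vector_derivative nderiv 1 \<eta> r) (at r)"
    using times_differentiable_onD[OF d, of 0] by simp
  show "(nderiv 1 \<eta> has_vector_derivative nderiv 2 \<eta> r) (at r)"
    using times_differentiable_onD[OF d, of 1] by (simp add: numeral_2_eq_2)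
  show "isCont (nderiv 2 \<eta>) r" by (rule c)
qed

text \<open>The expression \<open>w = (r \<eta>'')' - \<eta>' / r\<close> is a first integral of the equation \<open>L0 \<eta> = 0\<close>. Written in
this form, its constancy can also be used where a third derivative is not given.\<close>

definition flux_on :: "real set \<Rightarrow> (real \<Rightarrow> complex) \<Rightarrow> complex \<Rightarrow> bool" where
  "flux_on S \<eta> w \<longleftrightarrow> (\<forall>r\<in>S. ((\<lambda>r. r *\<^sub>R nderiv 2 \<eta> r) has_vector_derivative w + (1 / r) *\<^sub>R nderiv 1 \<eta> r) (at r))"

lemma has_vector_derivative_zero_interval:
  fixes f :: "real \<Rightarrow> 'a::real_normed_vector"
  assumes "\<And>r. r \<in> S \<Longrightarrow> (f has_vector_derivative 0) (at r)" "convex S"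
  obtains c where "\<And>r. r \<in> S \<Longrightarrow> f r = c"
  using has_vector_derivative_zero_constant[OF assms(2), of f] assms(1)
  by (meson has_vector_derivative_at_within)

lemma flux_from_third_derivative:
  assumes "(nderiv 2 \<eta> has_vector_derivative nderiv 3 \<eta> r) (at r)"
    and "r *\<^sub>R nderiv 3 \<eta> r + nderiv 2 \<eta> r - (1 / r) *\<^sub>R nderiv 1 \<eta> r = w"
  shows "((\<lambda>r. r *\<^sub>R nderiv 2 \<eta> r) has_vector_derivative w + (1 / r) *\<^sub>R nderiv 1 \<eta> r) (at r)"
proof -
  have "((\<lambda>r. r *\<^sub>R nderiv 2 \<eta> r) has_vector_derivative r *\<^sub>R nderiv 3 \<eta> r + 1 *\<^sub>R nderiv 2 \<eta> r) (at r)"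
    by (intro derivative_intros assms)
  moreover have "r *\<^sub>R nderiv 3 \<eta> r + 1 *\<^sub>R nderiv 2 \<eta> r = w + (1 / r) *\<^sub>R nderiv 1 \<eta> r"
    using assms(2) by (simp add: algebra_simps)
  ultimately show ?thesis by simp
qed

lemma has_vector_derivative_inverse_scale:
  assumes "(f has_vector_derivative f') (at r)" "r \<noteq> 0"
  shows "((\<lambda>x. (1 / x) *\<^sub>R f x) has_vector_derivative (1 / r) *\<^sub>R f' - (1 / r\<^sup>2) *\<^sub>R f r) (at (r::real))"
proof -
  have "((\<lambda>x. (1 / x)) has_field_derivative (- (1 / r\<^sup>2))) (at r)"
    using assms(2) by (auto intro!: derivative_eq_intros simp: power2_eq_square)
  from has_vector_derivative_scaleR[OF this assms(1)] show ?thesis by simp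
qed

text \<open>The expression \<open>r \<eta>''' + \<eta>'' - \<eta>' / r\<close> has derivative \<open>L0 \<eta>\<close>.\<close>

lemma L0_flux:
  assumes d: "times_differentiable_on 4 \<eta> {u<..<v}" and L: "\<And>r. r \<in> {u<..<v} \<Longrightarrow> L0 \<eta> r = 0" and "0 < u"
  obtains w where "flux_on {u<..<v} \<eta> w"
proof -
  let ?W = "\<lambda>r. r *\<^sub>R nderiv 3 \<eta> r + nderiv 2 \<eta> r - (1 / r) *\<^sub>R nderiv 1 \<eta> r"
  have der: "(nderiv 1 \<eta> has_vector_derivative nderiv 2 \<eta> r) (at r)"
    "(nderiv 2 \<eta> has_vector_derivative nderiv 3 \<eta> r) (at r)"
    "(nderiv 3 \<eta> has_vector_derivative nderiv 4 \<eta> r) (at r)" if "r \<in> {u<..<v}" for r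
    using times_differentiable_onD[OF d _ that, of 1] times_differentiable_onD[OF d _ that, of 2]
      times_differentiable_onD[OF d _ that, of 3] by (simp_all add: eval_nat_numeral)
  have "(?W has_vector_derivative 0) (at r)" if r: "r \<in> {u<..<v}" for r
  proof -
    have "(?W has_vector_derivative
       (r *\<^sub>R nderiv 4 \<eta> r + 1 *\<^sub>R nderiv 3 \<eta> r) + nderiv 3 \<eta> r - ((1 / r) *\<^sub>R nderiv 2 \<eta> r - (1 / r\<^sup>2) *\<^sub>R nderiv 1 \<eta> r)) (at r)"
      using \<open>0 < u\<close> r by (intro derivative_intros has_vector_derivative_inverse_scale der) auto
    moreover have "(r *\<^sub>R nderiv 4 \<eta> r + 1 *\<^sub>R nderiv 3 \<eta> r) + nderiv 3 \<eta> r - ((1 / r) *\<^sub>R nderiv 2 \<eta> r - (1 / r\<^sup>2) *\<^sub>R nderiv 1 \<eta> r) = L0 \<eta> r"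
      by (simp add: L0_def scaleR_2)
    ultimately show ?thesis using L[OF r] by simp
  qed
  then obtain w where "\<And>r. r \<in> {u<..<v} \<Longrightarrow> ?W r = w"
    using has_vector_derivative_zero_interval[of "{u<..<v}" ?W] by auto
  then have "flux_on {u<..<v} \<eta> w"
    unfolding flux_on_def using flux_from_third_derivative der(2) by blast
  then show thesis by (rule that)
qed

text \<open>The equation \<open>G0 \<eta> = 0\<close> makes \<open>\<eta>'' - \<eta>' / r\<close> a constant \<open>w\<close>. As this is \<open>r (\<eta>' / r)'\<close>, the quotient
\<open>\<eta>' / r\<close> is \<open>w ln r\<close> up to a constant. The flux is \<open>2 w\<close> because \<open>G0 \<eta> = 0\<close> also gives
\<open>r \<eta>''' = \<eta>'' - \<eta>' / r\<close>.\<close>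

lemma G0_profile:
  assumes d: "times_differentiable_on 3 \<eta> {0<..<v}" and G: "\<And>r. r \<in> {0<..<v} \<Longrightarrow> G0 \<eta> r = 0"
  obtains w c where "flux_on {0<..<v} \<eta> (2 *\<^sub>R w)"
    "\<And>r. r \<in> {0<..<v} \<Longrightarrow> nderiv 1 \<eta> r = r *\<^sub>R (ln r *\<^sub>R w + c)"
    "\<And>r. r \<in> {0<..<v} \<Longrightarrow> nderiv 2 \<eta> r = w + ln r *\<^sub>R w + c"
proof -
  have der: "(nderiv 1 \<eta> has_vector_derivative nderiv 2 \<eta> r) (at r)"
    "(nderiv 2 \<eta> has_vector_derivative nderiv 3 \<eta> r) (at r)" if "r \<in> {0<..<v}" for r
    using times_differentiable_onD[OF d _ that, of 1] times_differentiable_onD[OF d _ that, of 2]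
    by (simp_all add: eval_nat_numeral)
  let ?V = "\<lambda>r. nderiv 2 \<eta> r - (1 / r) *\<^sub>R nderiv 1 \<eta> r"
  have "(?V has_vector_derivative 0) (at r)" if r: "r \<in> {0<..<v}" for r
  proof -
    have "(?V has_vector_derivative nderiv 3 \<eta> r - ((1 / r) *\<^sub>R nderiv 2 \<eta> r - (1 / r\<^sup>2) *\<^sub>R nderiv 1 \<eta> r)) (at r)"
      using r by (intro derivative_intros has_vector_derivative_inverse_scale der) auto
    then show ?thesis using G[OF r] by (simp add: G0_def algebra_simps)
  qed
  then obtain w where w: "\<And>r. r \<in> {0<..<v} \<Longrightarrow> ?V r = w"
    using has_vector_derivative_zero_interval[of "{0<..<v}" ?V] by auto
  let ?U = "\<lambda>r. (1 / r) *\<^sub>R nderiv 1 \<eta> r - ln r *\<^sub>R w"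
  have "(?U has_vector_derivative 0) (at r)" if r: "r \<in> {0<..<v}" for r
  proof -
    have "((\<lambda>r. ln r *\<^sub>R w) has_vector_derivative (1 / r) *\<^sub>R w) (at r)"
      using has_vector_derivative_scaleR[OF DERIV_ln_divide has_vector_derivative_const[of w]] r by simp
    then have "(?U has_vector_derivative ((1 / r) *\<^sub>R nderiv 2 \<eta> r - (1 / r\<^sup>2) *\<^sub>R nderiv 1 \<eta> r) - (1 / r) *\<^sub>R w) (at r)"
      using r by (intro has_vector_derivative_diff has_vector_derivative_inverse_scale der) auto
    moreover have "((1 / r) *\<^sub>R nderiv 2 \<eta> r - (1 / r\<^sup>2) *\<^sub>R nderiv 1 \<eta> r) - (1 / r) *\<^sub>R w = (1 / r) *\<^sub>R (?V r - w)"
      by (simp add: algebra_simps power2_eq_square)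
    ultimately show ?thesis using w[OF r] by simp
  qed
  then obtain c where c: "\<And>r. r \<in> {0<..<v} \<Longrightarrow> ?U r = c"
    using has_vector_derivative_zero_interval[of "{0<..<v}" ?U] by auto
  have n1: "nderiv 1 \<eta> r = r *\<^sub>R (ln r *\<^sub>R w + c)" if r: "r \<in> {0<..<v}" for r
  proof -
    have "ln r *\<^sub>R w + c = (1 / r) *\<^sub>R nderiv 1 \<eta> r" using c[OF r] by (simp add: algebra_simps)
    then show ?thesis using r by simp
  qed
  have n2: "nderiv 2 \<eta> r = w + ln r *\<^sub>R w + c" if r: "r \<in> {0<..<v}" for r
  proof -
    have "nderiv 2 \<eta> r = w + (1 / r) *\<^sub>R nderiv 1 \<eta> r" using w[OF r] by (simp add: algebra_simps)
    also have "(1 / r) *\<^sub>R nderiv 1 \<eta> r = ln r *\<^sub>R w + c" using c[OF r] by (simp add: algebra_simps)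
    finally show ?thesis by (simp add: add.assoc)
  qed
  have "flux_on {0<..<v} \<eta> (2 *\<^sub>R w)"
    unfolding flux_on_def
  proof (intro ballI flux_from_third_derivative der)
    fix r assume r: "r \<in> {0<..<v}"
    have "nderiv 3 \<eta> r = (1 / r) *\<^sub>R ?V r"
      using G[OF r] by (simp add: G0_def algebra_simps power2_eq_square)
    then show "r *\<^sub>R nderiv 3 \<eta> r + nderiv 2 \<eta> r - (1 / r) *\<^sub>R nderiv 1 \<eta> r = 2 *\<^sub>R w"
      using w[OF r] r by (simp add: scaleR_2)
  qed
  then show thesis using that n1 n2 by blast
qed

text \<open>The equation \<open>R0 \<eta> = 0\<close> says that \<open>(r \<eta>')' = 0\<close>.\<close>

lemma R0_profile:
  assumes d: "times_differentiable_on 2 \<eta> {u<..}" and R: "\<And>r. r \<in> {u<..} \<Longrightarrow> R0 \<eta> r = 0" and "0 < u"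
  obtains c where "flux_on {u<..} \<eta> 0"
    "\<And>r. r \<in> {u<..} \<Longrightarrow> nderiv 1 \<eta> r = (1 / r) *\<^sub>R c"
    "\<And>r. r \<in> {u<..} \<Longrightarrow> nderiv 2 \<eta> r = - ((1 / r\<^sup>2) *\<^sub>R c)"
proof -
  have der: "(nderiv 1 \<eta> has_vector_derivative nderiv 2 \<eta> r) (at r)" if "r \<in> {u<..}" for r
    using times_differentiable_onD[OF d _ that, of 1] by (simp add: eval_nat_numeral)
  have eq: "r *\<^sub>R nderiv 2 \<eta> r + nderiv 1 \<eta> r = 0" if "r \<in> {u<..}" for r
  proof -
    have "r *\<^sub>R nderiv 2 \<eta> r + nderiv 1 \<eta> r = r\<^sup>2 *\<^sub>R R0 \<eta> r"
      using that \<open>0 < u\<close> by (simp add: R0_def algebra_simps power2_eq_square)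
    then show ?thesis using R[OF that] by simp
  qed
  have "((\<lambda>r. r *\<^sub>R nderiv 1 \<eta> r) has_vector_derivative 0) (at r)" if r: "r \<in> {u<..}" for r
  proof -
    have "((\<lambda>r. r *\<^sub>R nderiv 1 \<eta> r) has_vector_derivative r *\<^sub>R nderiv 2 \<eta> r + 1 *\<^sub>R nderiv 1 \<eta> r) (at r)"
      by (intro derivative_intros der r)
    then show ?thesis using eq[OF r] by simp
  qed
  then obtain c where c: "\<And>r. r \<in> {u<..} \<Longrightarrow> r *\<^sub>R nderiv 1 \<eta> r = c"
    using has_vector_derivative_zero_interval[of "{u<..}" "\<lambda>r. r *\<^sub>R nderiv 1 \<eta> r"] by auto
  have n1: "nderiv 1 \<eta> r = (1 / r) *\<^sub>R c" if "r \<in> {u<..}" for r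
    using c[OF that, symmetric] that \<open>0 < u\<close> by simp
  have n2: "r *\<^sub>R nderiv 2 \<eta> r = - nderiv 1 \<eta> r" if "r \<in> {u<..}" for r
    using eq[OF that] by (simp add: eq_neg_iff_add_eq_0)
  have n2': "nderiv 2 \<eta> r = - ((1 / r\<^sup>2) *\<^sub>R c)" if r: "r \<in> {u<..}" for r
  proof -
    have "r *\<^sub>R nderiv 2 \<eta> r = r *\<^sub>R (- ((1 / r\<^sup>2) *\<^sub>R c))"
      using n2[OF r] n1[OF r] r \<open>0 < u\<close> by (simp add: power2_eq_square)
    then show ?thesis using r \<open>0 < u\<close> by (simp only: scaleR_cancel_left) auto
  qed
  have "flux_on {u<..} \<eta> 0"
    unfolding flux_on_def
  proof
    fix r assume r: "r \<in> {u<..}"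
    have "((\<lambda>r. - nderiv 1 \<eta> r) has_vector_derivative - nderiv 2 \<eta> r) (at r)"
      by (intro derivative_intros der r)
    moreover have "- nderiv 2 \<eta> r = 0 + (1 / r) *\<^sub>R nderiv 1 \<eta> r"
      using n1[OF r] n2'[OF r] by (simp add: power2_eq_square)
    ultimately have "((\<lambda>r. - nderiv 1 \<eta> r) has_vector_derivative 0 + (1 / r) *\<^sub>R nderiv 1 \<eta> r) (at r)" by simp
    then show "((\<lambda>r. r *\<^sub>R nderiv 2 \<eta> r) has_vector_derivative 0 + (1 / r) *\<^sub>R nderiv 1 \<eta> r) (at r)"
      by (rule has_vector_derivative_transform_within_open[where S = "{u<..}"]) (use r n2 in auto)
  qed
  then show thesis using that n1 n2' by blast
qed

lemma ac_on_C1: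
  fixes f f' :: "real \<Rightarrow> complex"
  assumes f: "continuous_on {u..v} f" "continuous_on {u..v} f'"
    "\<And>r. r \<in> {u<..<v} \<Longrightarrow> (f has_vector_derivative f' r) (at r)"
  shows "ac_on u v f"
proof -
  have "bounded (f' ` {u..v})"
    using f(2) by (auto intro: compact_imp_bounded compact_continuous_image)
  then obtain B where B: "\<And>r. r \<in> {u..v} \<Longrightarrow> norm (f' r) \<le> B" unfolding bounded_iff by blast
  show ?thesis
  proof (rule ac_on_lipschitz)
    fix s t assume st: "u \<le> s" "s \<le> t" "t \<le> v"
    show "norm (f t - f s) \<le> B * (t - s)"
    proof (cases "s < t")
      case True
      have "continuous_on {s..t} f" using f(1) st by (auto intro: continuous_on_subset)
      moreover have "(f has_derivative (\<lambda>h. h *\<^sub>R f' r)) (at r)" if "s < r" "r < t" for r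
        using f(3)[of r] st that by (simp add: has_vector_derivative_def)
      ultimately obtain r where r: "r \<in> {s<..<t}" "norm (f t - f s) \<le> norm ((t - s) *\<^sub>R f' r)"
        using mvt_general[OF True, of f "\<lambda>r h. h *\<^sub>R f' r"] by blast
      have "norm ((t - s) *\<^sub>R f' r) \<le> B * (t - s)"
        using B[of r] r(1) st by (simp add: mult.commute mult_right_mono)
      with r(2) show ?thesis by linarith
    qed (use st in simp)
  qed
qed

text \<open>The boundary expression \<open>r \<eta>'' \<bullet> k - w \<bullet> h\<close> is an antiderivative almost everywhere: by the flux
equation its derivative is \<open>r \<eta>'' \<bullet> k' + (w + \<eta>' / r) \<bullet> k - w \<bullet> k\<close>. It is absolutely continuous up to
the end points of the piece, where the flux equation need not hold, because \<open>r \<eta>''\<close> is continuous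
there and has a bounded derivative inside.\<close>

lemma integration_by_parts_on_piece:
  fixes \<eta> h k k' :: "real \<Rightarrow> complex"
  assumes uv: "0 < u" "u \<le> v"
    and cont: "continuous_on {u..v} (nderiv 1 \<eta>)" "continuous_on {u..v} (nderiv 2 \<eta>)"
    and flux: "flux_on {u<..<v} \<eta> w"
    and h: "\<And>r. r \<in> {u..v} \<Longrightarrow> (h has_vector_derivative k r) (at r)"
    and k: "ac_on u v k" and N: "negligible N" "\<And>r. r \<in> {u..v} - N \<Longrightarrow> (k has_vector_derivative k' r) (at r)"
  shows "((\<lambda>r. r * (nderiv 2 \<eta> r \<bullet> k' r) + (1 / r) * (nderiv 1 \<eta> r \<bullet> k r)) has_integral
    ((v *\<^sub>R nderiv 2 \<eta> v) \<bullet> k v - w \<bullet> h v) - ((u *\<^sub>R nderiv 2 \<eta> u) \<bullet> k u - w \<bullet> h u)) {u..v}"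
proof -
  let ?q = "\<lambda>r. r *\<^sub>R nderiv 2 \<eta> r"
  have "ac_on u v ?q"
  proof (rule ac_on_C1)
    show "continuous_on {u..v} ?q" using cont by (intro continuous_intros)
    show "continuous_on {u..v} (\<lambda>r. w + (1 / r) *\<^sub>R nderiv 1 \<eta> r)"
      using cont uv by (intro continuous_intros) auto
  qed (use flux in \<open>auto simp: flux_on_def\<close>)
  moreover have "ac_on u v h"
  proof (rule ac_on_C1)
    show "continuous_on {u..v} h"
      using has_vector_derivative_continuous[OF h] by (intro continuous_at_imp_continuous_on) blast
  qed (use h ac_on_continuous[OF k] in auto)
  moreover have "ac_on u v (\<lambda>r. w)" by (rule ac_on_lipschitz[where C = 0]) simp
  ultimately have ac: "ac_on u v (\<lambda>r. ?q r \<bullet> k r - w \<bullet> h r)"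
    using k by (intro ac_on_diff ac_on_inner)
  have der: "((\<lambda>r. ?q r \<bullet> k r - w \<bullet> h r) has_vector_derivative
     r * (nderiv 2 \<eta> r \<bullet> k' r) + (1 / r) * (nderiv 1 \<eta> r \<bullet> k r)) (at r within {u..v})"
    if r: "r \<in> {u..v} - (N \<union> {u, v})" for r
  proof -
    note inner_deriv = bounded_bilinear.has_vector_derivative[OF bounded_bilinear_inner]
    have "((\<lambda>r. ?q r \<bullet> k r) has_vector_derivative
      ?q r \<bullet> k' r + (w + (1 / r) *\<^sub>R nderiv 1 \<eta> r) \<bullet> k r) (at r)"
      using flux r N by (intro inner_deriv) (auto simp: flux_on_def)
    moreover have "((\<lambda>r. w \<bullet> h r) has_vector_derivative w \<bullet> k r + 0 \<bullet> h r) (at r)"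
      using h r by (intro inner_deriv) auto
    ultimately have "((\<lambda>r. ?q r \<bullet> k r - w \<bullet> h r) has_vector_derivative
      (?q r \<bullet> k' r + (w + (1 / r) *\<^sub>R nderiv 1 \<eta> r) \<bullet> k r) - (w \<bullet> k r + 0 \<bullet> h r)) (at r)"
      by (rule has_vector_derivative_diff)
    moreover have "(?q r \<bullet> k' r + (w + (1 / r) *\<^sub>R nderiv 1 \<eta> r) \<bullet> k r) - (w \<bullet> k r + 0 \<bullet> h r)
      = r * (nderiv 2 \<eta> r \<bullet> k' r) + (1 / r) * (nderiv 1 \<eta> r \<bullet> k r)"
      by (simp add: inner_add_left)
    ultimately show ?thesis by (metis has_vector_derivative_at_within)
  qed
  have "negligible (N \<union> {u, v})" using N(1) by simp
  from ac_on_fundamental_theorem[OF ac uv(2) this der] show ?thesis by simp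
qed

section \<open>Behaviour at the two ends of the half-line\<close>

lemma tendsto_x_ln_0: "((\<lambda>x::real. x * ln x) \<longlongrightarrow> 0) (at_right 0)"
proof -
  have "((\<lambda>x::real. - (ln x / x)) \<longlongrightarrow> - 0) at_top"
    by (intro tendsto_minus ln_x_over_x_tendsto_0)
  moreover have "filterlim (\<lambda>x::real. inverse x) at_top (at_right 0)"
    by (rule filterlim_inverse_at_top_right)
  ultimately have "((\<lambda>x. - (ln (inverse x) / inverse x)) \<longlongrightarrow> - 0) (at_right (0::real))"
    by (rule filterlim_compose)
  moreover have "\<forall>\<^sub>F x in at_right (0::real). - (ln (inverse x) / inverse x) = x * ln x"
    using eventually_at_right_less[of "0::real"] by eventually_elim (simp add: ln_inverse divide_inverse mult.commute)
  ultimately show ?thesis by (simp add: tendsto_cong)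
qed

text \<open>Near zero \<open>\<eta>' = r (w ln r + c)\<close>, so both limits reduce to \<open>r ln r \<longlongrightarrow> 0\<close>. A non-singular spline has
\<open>\<eta>' / r\<close> constant, which leaves no room for the logarithm.\<close>

lemma S0_near_zero:
  assumes \<eta>: "\<eta> \<in> S0 n \<rho>" and "0 < \<rho> 1"
  obtains w where "flux_on {0<..<\<rho> 1} \<eta> w"
    "((\<lambda>r. r *\<^sub>R nderiv 2 \<eta> r) \<longlongrightarrow> 0) (at_right 0)" "(nderiv 1 \<eta> \<longlongrightarrow> 0) (at_right 0)"
    "nonsingular_spline \<rho> \<eta> \<Longrightarrow> w = 0"
proof -
  have d: "times_differentiable_on 3 \<eta> {0<..<\<rho> 1}" and G: "\<And>r. r \<in> {0<..<\<rho> 1} \<Longrightarrow> G0 \<eta> r = 0"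
    using \<eta> by (auto simp: S0_def)
  obtain w c where wc: "flux_on {0<..<\<rho> 1} \<eta> (2 *\<^sub>R w)"
    "\<And>r. r \<in> {0<..<\<rho> 1} \<Longrightarrow> nderiv 1 \<eta> r = r *\<^sub>R (ln r *\<^sub>R w + c)"
    "\<And>r. r \<in> {0<..<\<rho> 1} \<Longrightarrow> nderiv 2 \<eta> r = w + ln r *\<^sub>R w + c"
    using G0_profile[OF d G] by blast
  have near: "\<forall>\<^sub>F r in at_right 0. r \<in> {0<..<\<rho> 1}"
    using eventually_at_right_real[OF \<open>0 < \<rho> 1\<close>] .
  have l1: "((\<lambda>r. (r * ln r) *\<^sub>R w + r *\<^sub>R c) \<longlongrightarrow> 0 *\<^sub>R w + 0 *\<^sub>R c) (at_right 0)"
    by (intro tendsto_intros tendsto_x_ln_0)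
  moreover have "\<forall>\<^sub>F r in at_right 0. (r * ln r) *\<^sub>R w + r *\<^sub>R c = nderiv 1 \<eta> r"
    using near by eventually_elim (simp add: wc scaleR_add_right del: One_nat_def)
  ultimately have lim1: "(nderiv 1 \<eta> \<longlongrightarrow> 0) (at_right 0)" by (simp add: tendsto_cong)
  have "((\<lambda>r. r *\<^sub>R w + ((r * ln r) *\<^sub>R w + r *\<^sub>R c)) \<longlongrightarrow> 0 *\<^sub>R w + (0 *\<^sub>R w + 0 *\<^sub>R c)) (at_right 0)"
    by (intro tendsto_intros tendsto_x_ln_0)
  moreover have "\<forall>\<^sub>F r in at_right 0. r *\<^sub>R w + ((r * ln r) *\<^sub>R w + r *\<^sub>R c) = r *\<^sub>R nderiv 2 \<eta> r"
    using near by eventually_elim (simp add: wc scaleR_add_right add.assoc del: One_nat_def)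
  ultimately have lim2: "((\<lambda>r. r *\<^sub>R nderiv 2 \<eta> r) \<longlongrightarrow> 0) (at_right 0)" by (simp add: tendsto_cong)
  have "2 *\<^sub>R w = 0" if ns: "nonsingular_spline \<rho> \<eta>"
  proof -
    obtain p q where pq: "\<And>r. r \<in> {0<..<\<rho> 1} \<Longrightarrow> \<eta> r = p * (of_real r)\<^sup>2 + q"
      using ns unfolding nonsingular_spline_def by blast
    have "ln r *\<^sub>R w + c = 2 * p" if r: "r \<in> {0<..<\<rho> 1}" for r
    proof -
      have "((\<lambda>x. p * (of_real x)\<^sup>2 + q) has_vector_derivative r *\<^sub>R (2 * p)) (at r)"
        by (auto intro!: derivative_eq_intros simp: has_vector_derivative_def scaleR_conv_of_real algebra_simps)
      then have "(\<eta> has_vector_derivative r *\<^sub>R (2 * p)) (at r)"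
        by (rule has_vector_derivative_transform_within_open[where S = "{0<..<\<rho> 1}"]) (use r pq in auto)
      then have "nderiv 1 \<eta> r = r *\<^sub>R (2 * p)"
        by (simp add: nderiv_Suc vector_derivative_at)
      then have "r *\<^sub>R (ln r *\<^sub>R w + c) = r *\<^sub>R (2 * p)" using wc(2)[OF r] by metis
      then show ?thesis using r by (metis greaterThanLessThan_iff less_irrefl scaleR_cancel_left)
    qed
    from this[of "\<rho> 1 / 2"] this[of "\<rho> 1 / 3"] \<open>0 < \<rho> 1\<close>
    have "ln (\<rho> 1 / 2) *\<^sub>R w + c = ln (\<rho> 1 / 3) *\<^sub>R w + c" by simp
    then have "(ln (\<rho> 1 / 2) - ln (\<rho> 1 / 3)) *\<^sub>R w = 0" by (simp add: scaleR_diff_left)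
    moreover have "ln (\<rho> 1 / 2) \<noteq> ln (\<rho> 1 / 3)" using \<open>0 < \<rho> 1\<close> by simp
    ultimately show ?thesis by simp
  qed
  then show thesis using that wc(1) lim1 lim2 by blast
qed

lemma S0_near_infinity:
  assumes \<eta>: "\<eta> \<in> S0 n \<rho>" and "0 < \<rho> n"
  shows "flux_on {\<rho> n<..} \<eta> 0"
    and "((\<lambda>r. r *\<^sub>R nderiv 2 \<eta> r) \<longlongrightarrow> 0) at_top" and "(nderiv 1 \<eta> \<longlongrightarrow> 0) at_top"
proof -
  have d: "times_differentiable_on 2 \<eta> {\<rho> n<..}" and R: "\<And>r. r \<in> {\<rho> n<..} \<Longrightarrow> R0 \<eta> r = 0"
    using \<eta> by (auto simp: S0_def)
  obtain c where c: "flux_on {\<rho> n<..} \<eta> 0"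
    "\<And>r. r \<in> {\<rho> n<..} \<Longrightarrow> nderiv 1 \<eta> r = (1 / r) *\<^sub>R c"
    "\<And>r. r \<in> {\<rho> n<..} \<Longrightarrow> nderiv 2 \<eta> r = - ((1 / r\<^sup>2) *\<^sub>R c)"
    using R0_profile[OF d R \<open>0 < \<rho> n\<close>] by blast
  show "flux_on {\<rho> n<..} \<eta> 0" by fact
  have far: "\<forall>\<^sub>F r in at_top. r \<in> {\<rho> n<..}" using eventually_gt_at_top[of "\<rho> n"] by simp
  have "((\<lambda>r::real. (1 / r) *\<^sub>R c) \<longlongrightarrow> 0 *\<^sub>R c) at_top"
    by (intro tendsto_intros tendsto_divide_0[OF tendsto_const] filterlim_at_top_imp_at_infinity filterlim_ident)
  then have lim: "((\<lambda>r::real. (1 / r) *\<^sub>R c) \<longlongrightarrow> 0) at_top" by simp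
  have "\<forall>\<^sub>F r in at_top. (1 / r) *\<^sub>R c = nderiv 1 \<eta> r"
    using far by eventually_elim (simp add: c del: One_nat_def)
  with lim show "(nderiv 1 \<eta> \<longlongrightarrow> 0) at_top" by (simp add: tendsto_cong)
  have "\<forall>\<^sub>F r in at_top. - ((1 / r) *\<^sub>R c) = r *\<^sub>R nderiv 2 \<eta> r"
    using far by eventually_elim (use \<open>0 < \<rho> n\<close> in \<open>simp add: c power2_eq_square\<close>)
  with tendsto_minus[OF lim] show "((\<lambda>r. r *\<^sub>R nderiv 2 \<eta> r) \<longlongrightarrow> 0) at_top" by (simp add: tendsto_cong)
qed

lemma energy0_nonneg: "0 < r \<Longrightarrow> 0 \<le> energy0 f r"
  by (simp add: energy0_def)

lemma Lambda0_C1: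
  assumes "f \<in> Lambda0"
  shows "\<And>r. 0 < r \<Longrightarrow> (f has_vector_derivative nderiv 1 f r) (at r)"
    and "continuous_on {0<..} (nderiv 1 f)"
proof -
  obtain D where D: "\<And>x. 0 < x \<Longrightarrow> (f has_vector_derivative D x) (at x)" "continuous_on {0<..} D"
    using assms by (auto simp: Lambda0_def C1_differentiable_on_def)
  have eq: "nderiv 1 f x = D x" if "0 < x" for x
    using vector_derivative_at[OF D(1)[OF that]] by (simp add: nderiv_Suc)
  show "\<And>r. 0 < r \<Longrightarrow> (f has_vector_derivative nderiv 1 f r) (at r)" using D(1) eq by simp
  show "continuous_on {0<..} (nderiv 1 f)" 
    by (rule continuous_on_eq[OF D(2)]) (simp add: eq del: One_nat_def)
qed

lemma Lambda0_ac_on: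
  assumes "f \<in> Lambda0" "0 < a" "a < b" shows "ac_on a b (nderiv 1 f)"
  using assms by (auto simp: Lambda0_def intro: abs_continuous_imp_ac_on)

text \<open>The half-line is exhausted by countably many intervals on which \<open>f'\<close> is absolutely continuous.\<close>

lemma Lambda0_second_derivative:
  assumes f: "f \<in> Lambda0"
  obtains N where "negligible N"
    "\<And>r. 0 < r \<Longrightarrow> r \<notin> N \<Longrightarrow> (nderiv 1 f has_vector_derivative nderiv 2 f r) (at r)"
proof -
  have "\<exists>N. negligible N \<and> (\<forall>r\<in>{inverse (real (Suc m))<..<real (Suc m) + 1} - N. nderiv 1 f differentiable (at r))" for m
  proof -
    have "inverse (real (Suc m)) \<le> 1" by (simp add: field_simps)
    then have "inverse (real (Suc m)) < real (Suc m) + 1" by simp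
    then have "ac_on (inverse (real (Suc m))) (real (Suc m) + 1) (nderiv 1 f)"
      by (intro Lambda0_ac_on[OF f]) auto
    then show ?thesis using ac_on_complex_differentiable_ae by metis
  qed
  then obtain N where N: "\<And>m. negligible (N m)"
    "\<And>m r. r \<in> {inverse (real (Suc m))<..<real (Suc m) + 1} - N m \<Longrightarrow> nderiv 1 f differentiable (at r)"
    by metis
  show thesis
  proof (rule that[of "\<Union>m. N m"])
    show "negligible (\<Union>m. N m)" using N(1) by (rule negligible_Union_nat)
    fix r :: real assume r: "0 < r" "r \<notin> (\<Union>m. N m)"
    obtain m1 where m1: "inverse (real (Suc m1)) < r" using reals_Archimedean[OF r(1)] by blast
    obtain m2 :: nat where m2: "r < real m2" using reals_Archimedean2 by blast
    have "inverse (real (Suc (max m1 m2))) < r"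
      by (rule le_less_trans[OF _ m1]) (simp add: field_simps)
    moreover have "r < real (Suc (max m1 m2)) + 1" using m2 by simp
    ultimately have "r \<in> {inverse (real (Suc (max m1 m2)))<..<real (Suc (max m1 m2)) + 1}" by simp
    then have "nderiv 1 f differentiable (at r)" using N(2) r(2) by blast
    then show "(nderiv 1 f has_vector_derivative nderiv 2 f r) (at r)"
      by (simp add: vector_derivative_works numeral_2_eq_2 nderiv_Suc[of "Suc 0"])
  qed
qed

lemma Lambda0_energy:
  assumes f: "f \<in> Lambda0"
  shows "energy0 f integrable_on {0<..}"
    and "norm0 f = sqrt (integral {0<..} (energy0 f))"
  using f set_lebesgue_integral_eq_integral[of "{0<..}" "energy0 f"]
  by (simp_all add: Lambda0_def norm0_def)

lemma Lambda0_energy_interval: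
  assumes f: "f \<in> Lambda0" and "0 < a"
  shows "energy0 f integrable_on {a..b}"
    and "integral {a..b} (energy0 f) \<le> integral {0<..} (energy0 f)"
proof -
  have "set_integrable lebesgue {0<..} (energy0 f)" using f by (simp add: Lambda0_def)
  then have "set_integrable lebesgue {a..b} (energy0 f)"
    by (rule set_integrable_subset) (use \<open>0 < a\<close> in auto)
  then show int: "energy0 f integrable_on {a..b}"
    using set_lebesgue_integral_eq_integral(1) by blast
  show "integral {a..b} (energy0 f) \<le> integral {0<..} (energy0 f)"
    using int Lambda0_energy(1)[OF f] \<open>0 < a\<close> by (intro integral_subset_le) (auto simp: energy0_nonneg)
qed

text \<open>The derivative \<open>2 f' \<bullet> f''\<close> of \<open>\<bar>f'\<bar>\<^sup>2\<close> is bounded by the energy density, by the arithmetic-geometric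
mean inequality for \<open>sqrt r \<bar>f''\<bar>\<close> and \<open>\<bar>f'\<bar> / sqrt r\<close>. So \<open>\<bar>f'\<bar>\<^sup>2\<close> oscillates by at most the total
energy on the whole half-line.\<close>

lemma Lambda0_derivative_bounded:
  assumes f: "f \<in> Lambda0"
  obtains B where "\<And>r. 0 < r \<Longrightarrow> norm (nderiv 1 f r) \<le> B"
proof -
  let ?k = "nderiv 1 f" and ?k' = "nderiv 2 f"
  let ?E = "integral {0<..} (energy0 f)"
  obtain N where N: "negligible N" "\<And>r. 0 < r \<Longrightarrow> r \<notin> N \<Longrightarrow> (?k has_vector_derivative ?k' r) (at r)"
    using Lambda0_second_derivative[OF f] by blast
  have var: "\<bar>(norm (?k b))\<^sup>2 - (norm (?k a))\<^sup>2\<bar> \<le> ?E" if ab: "0 < a" "a < b" for a b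
  proof -
    have ac: "ac_on a b (\<lambda>r. ?k r \<bullet> ?k r)"
      by (intro ac_on_inner Lambda0_ac_on[OF f ab])
    have der: "((\<lambda>r. ?k r \<bullet> ?k r) has_vector_derivative ?k r \<bullet> ?k' r + ?k' r \<bullet> ?k r) (at r within {a..b})"
      if "r \<in> {a..b} - N" for r
    proof (rule has_vector_derivative_at_within)
      have "(?k has_vector_derivative ?k' r) (at r)" using that ab by (intro N(2)) auto
      from bounded_bilinear.has_vector_derivative[OF bounded_bilinear_inner this this]
      show "((\<lambda>r. ?k r \<bullet> ?k r) has_vector_derivative ?k r \<bullet> ?k' r + ?k' r \<bullet> ?k r) (at r)" .
    qed
    have int: "((\<lambda>r. ?k r \<bullet> ?k' r + ?k' r \<bullet> ?k r) has_integral ?k b \<bullet> ?k b - ?k a \<bullet> ?k a) {a..b}"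
      using ac_on_fundamental_theorem[OF ac _ N(1) der] ab by simp
    have bound: "\<bar>?k r \<bullet> ?k' r + ?k' r \<bullet> ?k r\<bar> \<le> energy0 f r" if "r \<in> {a..b}" for r
    proof -
      have r: "0 < r" using that ab by simp
      have "\<bar>?k r \<bullet> ?k' r + ?k' r \<bullet> ?k r\<bar> = 2 * \<bar>?k' r \<bullet> ?k r\<bar>" by (simp add: inner_commute)
      also have "\<dots> \<le> 2 * (norm (?k' r) * norm (?k r))" using Cauchy_Schwarz_ineq2[of "?k' r" "?k r"] by simp
      also have "\<dots> = 2 * ((sqrt r * norm (?k' r)) * (norm (?k r) / sqrt r))" using r by simp
      also have "\<dots> \<le> (sqrt r * norm (?k' r))\<^sup>2 + (norm (?k r) / sqrt r)\<^sup>2"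
        using sum_squares_bound[of "sqrt r * norm (?k' r)" "norm (?k r) / sqrt r"] by (simp only: mult.assoc)
      also have "\<dots> = energy0 f r" using r by (simp add: energy0_def power_mult_distrib power_divide)
      finally show ?thesis .
    qed
    have E: "(energy0 f has_integral integral {a..b} (energy0 f)) {a..b}"
      using Lambda0_energy_interval(1)[OF f ab(1)] by (rule integrable_integral)
    have "?k b \<bullet> ?k b - ?k a \<bullet> ?k a \<le> integral {a..b} (energy0 f)"
      by (rule has_integral_le[OF int E]) (use bound in \<open>auto simp: abs_le_iff\<close>)
    moreover have "- (?k b \<bullet> ?k b - ?k a \<bullet> ?k a) \<le> integral {a..b} (energy0 f)"
      by (rule has_integral_le[OF has_integral_neg[OF int] E]) (use bound in \<open>auto simp: abs_le_iff\<close>)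
    ultimately show ?thesis
      using Lambda0_energy_interval(2)[OF f ab(1), of b] by (simp add: power2_norm_eq_inner abs_le_iff)
  qed
  have sq: "(norm (?k r))\<^sup>2 \<le> (norm (?k 1))\<^sup>2 + ?E" if "0 < r" for r
  proof -
    have E: "0 \<le> ?E"
      by (intro integral_nonneg Lambda0_energy(1)[OF f]) (auto simp: energy0_nonneg)
    consider "r < 1" | "r = 1" | "1 < r" by linarith
    then show ?thesis
    proof cases
      case 1
      then show ?thesis using var[OF that 1] unfolding abs_le_iff by linarith
    next
      case 2
      with E show ?thesis by simp
    next
      case 3
      then show ?thesis using var[OF zero_less_one 3] unfolding abs_le_iff by linarith
    qed
  qed
  have "norm (?k r) \<le> sqrt ((norm (?k 1))\<^sup>2 + ?E)" if "0 < r" for r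
    using real_sqrt_le_mono[OF sq[OF that]] by simp
  then show thesis by (rule that)
qed

section \<open>Orthogonality and minimality\<close>

lemma has_vector_derivative_Lambda0_minus_S0:
  assumes "f \<in> Lambda0" and \<eta>: "\<eta> \<in> S0 n \<rho>" "1 \<le> n" "0 < \<rho> 1" "0 < \<rho> n" and "0 < r"
  shows "((\<lambda>r. f r - \<eta> r) has_vector_derivative nderiv 1 f r - nderiv 1 \<eta> r) (at r)"
  using Lambda0_C1(1)[OF assms(1) \<open>0 < r\<close>] S0_regular(1)[OF \<eta> \<open>0 < r\<close>]
  by (rule has_vector_derivative_diff)

lemma S0_continuous_derivatives:
  assumes \<eta>: "\<eta> \<in> S0 n \<rho>" "1 \<le> n" "0 < \<rho> 1" "0 < \<rho> n"
  shows "continuous_on {0<..} (nderiv 1 \<eta>)" and "continuous_on {0<..} (nderiv 2 \<eta>)"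
  using has_vector_derivative_continuous[OF S0_regular(2)[OF \<eta>]] S0_regular(3)[OF \<eta>]
  by (auto intro!: continuous_at_imp_continuous_on simp del: One_nat_def)

text \<open>Adding up the integrations by parts over all pieces, the terms \<open>r \<eta>'' \<bullet> k\<close> cancel at the knots because
\<open>\<eta>''\<close> is continuous there, and the flux terms disappear because \<open>h\<close> vanishes at the knots. Since the flux
beyond the last knot is zero, the only flux term left is the one at the left end.\<close>

lemma orthogonality_on_interval:
  fixes \<eta> h k k' :: "real \<Rightarrow> complex"
  assumes \<eta>: "\<eta> \<in> S0 n \<rho>" and n: "1 \<le> n" and \<rho>: "strict_mono_on {1..n} \<rho>" "0 < \<rho> 1"
    and flux: "flux_on {0<..<\<rho> 1} \<eta> w"
    and h: "\<And>r. 0 < r \<Longrightarrow> (h has_vector_derivative k r) (at r)"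
    and k: "\<And>u v. 0 < u \<Longrightarrow> u < v \<Longrightarrow> ac_on u v k"
    and N: "negligible N" "\<And>r. 0 < r \<Longrightarrow> r \<notin> N \<Longrightarrow> (k has_vector_derivative k' r) (at r)"
    and zero: "\<And>j. j \<in> {1..n} \<Longrightarrow> h (\<rho> j) = 0"
    and ab: "0 < a" "a < \<rho> 1" "\<rho> n < b"
  shows "((\<lambda>r. r * (nderiv 2 \<eta> r \<bullet> k' r) + (1 / r) * (nderiv 1 \<eta> r \<bullet> k r)) has_integral
    (b *\<^sub>R nderiv 2 \<eta> b) \<bullet> k b - (a *\<^sub>R nderiv 2 \<eta> a) \<bullet> k a + w \<bullet> h a) {a..b}"
proof -
  let ?X = "\<lambda>r. r * (nderiv 2 \<eta> r \<bullet> k' r) + (1 / r) * (nderiv 1 \<eta> r \<bullet> k r)"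
  let ?Q = "\<lambda>r. (r *\<^sub>R nderiv 2 \<eta> r) \<bullet> k r"
  have mono: "\<rho> 1 \<le> \<rho> j" if "j \<in> {1..n}" for j
    using strict_mono_on_leD[OF \<rho>(1), of 1 j] that by auto
  then have "0 < \<rho> n" using n \<rho>(2) by fastforce
  note reg = S0_regular[OF \<eta> n \<rho>(2) this]
  have piece: "(?X has_integral (?Q v - w' \<bullet> h v) - (?Q u - w' \<bullet> h u)) {u..v}"
    if "0 < u" "u < v" "flux_on {u<..<v} \<eta> w'" for u v w'
  proof (rule integration_by_parts_on_piece)
    have "{u..v} \<subseteq> {0<..}" using that by auto
    then show "continuous_on {u..v} (nderiv 1 \<eta>)" "continuous_on {u..v} (nderiv 2 \<eta>)"
      using S0_continuous_derivatives[OF \<eta> n \<rho>(2) \<open>0 < \<rho> n\<close>] continuous_on_subset by blast+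
  qed (use that h k N in auto)
  have middle: "(?X has_integral ?Q (\<rho> j) - ?Q (\<rho> 1)) {\<rho> 1..\<rho> j}" if "1 \<le> j" "j \<le> n" for j
    using that
  proof (induction j rule: dec_induct)
    case base
    then show ?case using has_integral_refl(2)[of ?X "\<rho> 1"] by (simp add: box_real)
  next
    case (step j)
    then have j: "j \<in> {1..<n}" by simp
    have lt: "\<rho> j < \<rho> (Suc j)" using strict_mono_onD[OF \<rho>(1), of j "Suc j"] step by auto
    have pos: "0 < \<rho> j" using mono[of j] j \<rho>(2) by auto
    have d: "times_differentiable_on 4 \<eta> {\<rho> j<..<\<rho> (Suc j)}" and L: "\<And>r. r \<in> {\<rho> j<..<\<rho> (Suc j)} \<Longrightarrow> L0 \<eta> r = 0"
      using \<eta> j by (auto simp: S0_def)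
    obtain w' where "flux_on {\<rho> j<..<\<rho> (Suc j)} \<eta> w'" using L0_flux[OF d L pos] by blast
    from piece[OF pos lt this] have new: "(?X has_integral ?Q (\<rho> (Suc j)) - ?Q (\<rho> j)) {\<rho> j..\<rho> (Suc j)}"
      using zero[of j] zero[of "Suc j"] step by simp
    have old: "(?X has_integral ?Q (\<rho> j) - ?Q (\<rho> 1)) {\<rho> 1..\<rho> j}" using step by simp
    have "j \<in> {1..n}" using j by simp
    from has_integral_combine[OF mono[OF this] less_imp_le[OF lt] old new]
    have "(?X has_integral (?Q (\<rho> j) - ?Q (\<rho> 1)) + (?Q (\<rho> (Suc j)) - ?Q (\<rho> j))) {\<rho> 1..\<rho> (Suc j)}" .
    moreover have "(?Q (\<rho> j) - ?Q (\<rho> 1)) + (?Q (\<rho> (Suc j)) - ?Q (\<rho> j)) = ?Q (\<rho> (Suc j)) - ?Q (\<rho> 1)"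
      by simp
    ultimately show ?case by (simp only:)
  qed
  have "flux_on {a<..<\<rho> 1} \<eta> w" using flux ab by (auto simp: flux_on_def)
  from piece[OF ab(1,2) this] have first: "(?X has_integral ?Q (\<rho> 1) - (?Q a - w \<bullet> h a)) {a..\<rho> 1}"
    using zero[of 1] n by simp
  have "flux_on {\<rho> n<..<b} \<eta> 0" using S0_near_infinity(1)[OF \<eta> \<open>0 < \<rho> n\<close>] by (auto simp: flux_on_def)
  from piece[OF \<open>0 < \<rho> n\<close> ab(3) this] have last: "(?X has_integral ?Q b - ?Q (\<rho> n)) {\<rho> n..b}"
    using zero[of n] n by simp
  have "\<rho> 1 \<le> \<rho> n" using mono[of n] n by simp
  have "(?X has_integral (?Q (\<rho> 1) - (?Q a - w \<bullet> h a)) + (?Q (\<rho> n) - ?Q (\<rho> 1))) {a..\<rho> n}"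
    using has_integral_combine[OF _ _ first middle[OF n order_refl]] ab(2) \<open>\<rho> 1 \<le> \<rho> n\<close> by simp
  from has_integral_combine[OF _ _ this last] ab \<open>\<rho> 1 \<le> \<rho> n\<close>
  have "(?X has_integral (?Q (\<rho> 1) - (?Q a - w \<bullet> h a)) + (?Q (\<rho> n) - ?Q (\<rho> 1)) + (?Q b - ?Q (\<rho> n))) {a..b}"
    by simp
  then show ?thesis by (simp add: algebra_simps)
qed

text \<open>Monotone convergence along the exhausting intervals. An upper bound on the integrals that converges
to \<open>M\<close> suffices, and it yields integrability at the same time; this is how the energy of the spline
is seen to be finite without computing it.\<close>

lemma integrable_by_exhaustion:
  fixes S :: "real \<Rightarrow> real" and a b T :: "nat \<Rightarrow> real"
  assumes nonneg: "\<And>r. 0 < r \<Longrightarrow> 0 \<le> S r"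
    and a: "decseq a" "a \<longlonglongrightarrow> 0" "\<And>i. 0 < a i" and b: "incseq b" "filterlim b at_top sequentially"
    and int: "\<And>i. S integrable_on {a i..b i}"
    and bound: "\<And>i. integral {a i..b i} S \<le> T i" "T \<longlonglongrightarrow> M"
  shows "S integrable_on {0<..}" and "integral {0<..} S \<le> M"
proof -
  let ?S = "\<lambda>i r. if r \<in> {a i..b i} then S r else 0"
  have sub: "{a i..b i} \<inter> {0<..} = {a i..b i}" for i using a(3)[of i] by auto
  have ints: "integral {0<..} (?S i) = integral {a i..b i} S" for i
    using Henstock_Kurzweil_Integration.integral_restrict_Int[of "{0<..}" "{a i..b i}" S] sub[of i] by simp
  have "0 \<le> integral {a i..b i} S" for i
    using a(3)[of i] by (intro integral_nonneg int nonneg) auto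
  moreover obtain C where "\<And>i. \<bar>T i\<bar> \<le> C"
    using convergent_imp_Bseq[OF convergentI[OF bound(2)]] by (auto simp: Bseq_def)
  ultimately have "norm (integral {a i..b i} S) \<le> C" for i
    using bound(1)[of i] by (smt (verit) real_norm_def)
  then have bdd: "bounded (range (\<lambda>i. integral {0<..} (?S i)))"
    unfolding bounded_iff ints by blast
  have "S integrable_on {0<..} \<and> (\<lambda>i. integral {0<..} (?S i)) \<longlonglongrightarrow> integral {0<..} S"
  proof (rule monotone_convergence_increasing[OF _ _ _ bdd])
    show "?S i integrable_on {0<..}" for i
      unfolding integrable_restrict_Int sub by (rule int)
    show "?S i r \<le> ?S (Suc i) r" if "r \<in> {0<..}" for i r
      using nonneg[of r] that decseq_SucD[OF a(1), of i] incseq_SucD[OF b(1), of i] by auto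
    show "(\<lambda>i. ?S i r) \<longlonglongrightarrow> S r" if r: "r \<in> {0<..}" for r
    proof -
      have "\<forall>\<^sub>F i in sequentially. a i < r" using order_tendstoD(2)[OF a(2)] r by simp
      moreover have "\<forall>\<^sub>F i in sequentially. r \<le> b i" using b(2) by (simp add: filterlim_at_top)
      ultimately have "\<forall>\<^sub>F i in sequentially. ?S i r = S r" by eventually_elim auto
      then show ?thesis by (rule tendsto_eventually)
    qed
  qed
  then show "S integrable_on {0<..}" and "integral {0<..} S \<le> M"
    using LIMSEQ_le[OF _ bound(2), of "\<lambda>i. integral {0<..} (?S i)" "integral {0<..} S"] bound(1) ints by auto
qed

lemma integral_pos_of_continuous_minorant:
  fixes E :: "real \<Rightarrow> real" and k :: "real \<Rightarrow> complex"
  assumes E: "E integrable_on {0<..}" "\<And>r. 0 < r \<Longrightarrow> (1 / r) * (norm (k r))\<^sup>2 \<le> E r"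
    and k: "continuous_on {0<..} k" and r0: "0 < r0" "k r0 \<noteq> 0"
  shows "0 < integral {0<..} E"
proof -
  let ?g = "\<lambda>r. (1 / r) * (norm (k r))\<^sup>2"
  have "continuous_on {0<..} ?g" using k by (intro continuous_intros) auto
  then have "isCont ?g r0" using r0 continuous_on_interior[of "{0<..}" ?g r0] by (simp add: interior_open)
  then have lim: "(?g \<longlongrightarrow> ?g r0) (at r0)" by (simp add: isCont_def)
  have g0: "0 < ?g r0" using r0 by simp
  then have "\<forall>\<^sub>F r in at r0. ?g r0 / 2 < ?g r" by (intro order_tendstoD(1)[OF lim]) simp
  then obtain d where d: "0 < d" "\<And>r. r \<noteq> r0 \<Longrightarrow> dist r r0 < d \<Longrightarrow> ?g r0 / 2 < ?g r"
    unfolding eventually_at by auto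
  define v where "v = r0 + d / 2"
  have v: "r0 < v" using d by (simp add: v_def)
  have ge: "?g r0 / 2 \<le> E r" if "r \<in> {r0..v}" for r
  proof -
    have "?g r0 / 2 \<le> ?g r"
      using d(2)[of r] that g0 \<open>0 < d\<close> by (cases "r = r0") (auto simp: v_def dist_real_def)
    also have "?g r \<le> E r" using E(2)[of r] that r0 by simp
    finally show ?thesis .
  qed
  have nonneg: "0 \<le> E r" if "0 < r" for r
  proof -
    have "0 \<le> ?g r" using that by simp
    then show ?thesis using E(2)[OF that] by linarith
  qed
  have sub: "E integrable_on {r0..v}"
  proof -
    have "E absolutely_integrable_on {0<..}"
      using nonneg by (intro nonnegative_absolutely_integrable_1[OF E(1)]) auto
    then have "E absolutely_integrable_on {r0..v}"
      by (rule set_integrable_subset) (use r0 in auto)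
    then show ?thesis using set_lebesgue_integral_eq_integral(1) by blast
  qed
  have "0 < (v - r0) * (?g r0 / 2)" using v by (intro mult_pos_pos half_gt_zero g0) simp
  also have "\<dots> = integral {r0..v} (\<lambda>r. ?g r0 / 2)" using v by simp
  also have "\<dots> \<le> integral {r0..v} E" using ge by (intro integral_le sub) auto
  also have "\<dots> \<le> integral {0<..} E" using nonneg r0 by (intro integral_subset_le sub E(1)) auto
  finally show ?thesis .
qed

text \<open>The cross term is the integrand of the orthogonality relation.\<close>

lemma energy_split:
  fixes s1 s2 f1 f2 :: complex
  assumes "0 < r"
  shows "r * (norm f2)\<^sup>2 + (1 / r) * (norm f1)\<^sup>2 =
    (r * (norm s2)\<^sup>2 + (1 / r) * (norm s1)\<^sup>2) + (r * (norm (f2 - s2))\<^sup>2 + (1 / r) * (norm (f1 - s1))\<^sup>2)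
    + 2 * (r * (s2 \<bullet> (f2 - s2)) + (1 / r) * (s1 \<bullet> (f1 - s1)))"
proof -
  have sq: "(norm x)\<^sup>2 = (norm y)\<^sup>2 + (norm (x - y))\<^sup>2 + 2 * (y \<bullet> (x - y))" for x y :: complex
    by (simp add: power2_norm_eq_inner inner_diff_left inner_diff_right inner_commute)
  show ?thesis by (subst sq[of f2 s2], subst sq[of f1 s1]) (simp add: algebra_simps)
qed

text \<open>With \<open>h = f - \<eta>\<close>, the energy densities of \<open>\<eta>\<close> and \<open>h\<close> add up to that of \<open>f\<close> minus twice the cross term \<open>X\<close>.
On \<open>[a, b]\<close> the integral of \<open>X\<close> consists of boundary terms, which vanish as \<open>a \<longlongrightarrow> 0\<close> and
\<open>b \<longlongrightarrow> \<infinity>\<close>, since \<open>f'\<close> is bounded and \<open>r \<eta>''\<close> and \<open>\<eta>'\<close> tend to zero at both ends; the assumption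
\<open>boundary\<close> takes care of the flux term at zero. So \<open>\<eta>\<close> and \<open>h\<close> together have at most the
energy of \<open>f\<close>, and the energy of \<open>h\<close> is positive.\<close>

theorem spline_minimises_energy:
  assumes \<eta>: "\<eta> \<in> S0 n \<rho>" and n: "1 \<le> n" and \<rho>: "strict_mono_on {1..n} \<rho>" "0 < \<rho> 1"
    and flux: "flux_on {0<..<\<rho> 1} \<eta> w"
    and lim0: "((\<lambda>r. r *\<^sub>R nderiv 2 \<eta> r) \<longlongrightarrow> 0) (at_right 0)" "(nderiv 1 \<eta> \<longlongrightarrow> 0) (at_right 0)"
    and f: "f \<in> Lambda0" and interp: "\<And>j. j \<in> {1..n} \<Longrightarrow> f (\<rho> j) = \<eta> (\<rho> j)"
    and boundary: "((\<lambda>r. w \<bullet> (f r - \<eta> r)) \<longlongrightarrow> 0) (at_right 0)"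
    and differ: "\<exists>r>0. f r \<noteq> \<eta> r"
  shows "norm0 \<eta> < norm0 f"
proof -
  define h where "h r = f r - \<eta> r" for r
  define k where "k r = nderiv 1 f r - nderiv 1 \<eta> r" for r
  define k' where "k' r = nderiv 2 f r - nderiv 2 \<eta> r" for r
  define X where "X r = r * (nderiv 2 \<eta> r \<bullet> k' r) + (1 / r) * (nderiv 1 \<eta> r \<bullet> k r)" for r
  define eh where "eh r = r * (norm (k' r))\<^sup>2 + (1 / r) * (norm (k r))\<^sup>2" for r
  define S where "S r = energy0 \<eta> r + eh r" for r
  have "\<rho> 1 \<le> \<rho> n" using strict_mono_on_leD[OF \<rho>(1), of 1 n] n by auto
  then have \<rho>n: "0 < \<rho> n" using \<rho>(2) by simp
  note reg = S0_regular[OF \<eta> n \<rho>(2) \<rho>n]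
  note cont\<eta> = S0_continuous_derivatives[OF \<eta> n \<rho>(2) \<rho>n]
  have hk: "(h has_vector_derivative k r) (at r)" if "0 < r" for r
    unfolding h_def k_def by (rule has_vector_derivative_Lambda0_minus_S0[OF f \<eta> n \<rho>(2) \<rho>n that])
  obtain N where N: "negligible N" "\<And>r. 0 < r \<Longrightarrow> r \<notin> N \<Longrightarrow> (nderiv 1 f has_vector_derivative nderiv 2 f r) (at r)"
    using Lambda0_second_derivative[OF f] by blast
  have kk': "(k has_vector_derivative k' r) (at r)" if "0 < r" "r \<notin> N" for r
    unfolding k_def k'_def using N(2)[OF that] reg(2)[OF that(1)] by (rule has_vector_derivative_diff)
  have kac: "ac_on u v k" if uv: "0 < u" "u < v" for u v
    unfolding k_def
  proof (rule ac_on_diff[OF Lambda0_ac_on[OF f uv]])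
    have sub: "{u..v} \<subseteq> {0<..}" using uv by auto
    show "ac_on u v (nderiv 1 \<eta>)"
      by (rule ac_on_C1[OF continuous_on_subset[OF cont\<eta>(1) sub] continuous_on_subset[OF cont\<eta>(2) sub]])
        (use reg(2) uv in auto)
  qed
  have hzero: "h (\<rho> j) = 0" if "j \<in> {1..n}" for j using interp[OF that] by (simp add: h_def)
  define Q where "Q r = (r *\<^sub>R nderiv 2 \<eta> r) \<bullet> k r" for r
  have X: "(X has_integral Q b - Q a + w \<bullet> h a) {a..b}" if "0 < a" "a < \<rho> 1" "\<rho> n < b" for a b
    unfolding X_def Q_def
    by (rule orthogonality_on_interval[OF \<eta> n \<rho> flux hk kac N(1) kk' hzero that])
  obtain B where B: "\<And>r. 0 < r \<Longrightarrow> norm (nderiv 1 f r) \<le> B" using Lambda0_derivative_bounded[OF f] by blast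
  have Qlim: "(Q \<longlongrightarrow> 0) F"
    if lim: "((\<lambda>r. r *\<^sub>R nderiv 2 \<eta> r) \<longlongrightarrow> 0) F" "(nderiv 1 \<eta> \<longlongrightarrow> 0) F" and pos: "\<forall>\<^sub>F r in F. 0 < r" for F
  proof (rule Lim_null_comparison)
    show "\<forall>\<^sub>F r in F. norm (Q r) \<le> norm (r *\<^sub>R nderiv 2 \<eta> r) * (B + norm (nderiv 1 \<eta> r))"
      using pos
    proof eventually_elim
      case (elim r)
      have "norm (Q r) \<le> norm (r *\<^sub>R nderiv 2 \<eta> r) * norm (k r)"
        unfolding Q_def real_norm_def by (rule Cauchy_Schwarz_ineq2)
      also have "norm (k r) \<le> norm (nderiv 1 f r) + norm (nderiv 1 \<eta> r)"
        unfolding k_def by (rule norm_triangle_ineq4)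
      then have "norm (r *\<^sub>R nderiv 2 \<eta> r) * norm (k r) \<le> norm (r *\<^sub>R nderiv 2 \<eta> r) * (B + norm (nderiv 1 \<eta> r))"
        using B[OF elim] by (intro mult_left_mono) auto
      finally show ?case .
    qed
    have "((\<lambda>r. norm (r *\<^sub>R nderiv 2 \<eta> r) * (B + norm (nderiv 1 \<eta> r))) \<longlongrightarrow> norm (0::complex) * (B + norm (0::complex))) F"
      by (intro tendsto_intros lim)
    then show "((\<lambda>r. norm (r *\<^sub>R nderiv 2 \<eta> r) * (B + norm (nderiv 1 \<eta> r))) \<longlongrightarrow> 0) F" by simp
  qed
  have pos0: "\<forall>\<^sub>F r in at_right (0::real). 0 < r" by (rule eventually_at_right_less)
  have Q0: "(Q \<longlongrightarrow> 0) (at_right 0)" by (rule Qlim[OF lim0 pos0])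
  have Qinf: "(Q \<longlongrightarrow> 0) at_top"
    by (rule Qlim[OF S0_near_infinity(2,3)[OF \<eta> \<rho>n] eventually_gt_at_top])
  have split: "S r = energy0 f r - 2 * X r" if "0 < r" for r
    using energy_split[OF that, of "nderiv 2 f r" "nderiv 1 f r" "nderiv 2 \<eta> r" "nderiv 1 \<eta> r"]
    by (simp add: S_def eh_def X_def energy0_def k_def k'_def)
  have eh_nonneg: "0 \<le> eh r" if "0 < r" for r using that by (simp add: eh_def)
  have S_nonneg: "0 \<le> S r" if "0 < r" for r
    using that energy0_nonneg[OF that, of \<eta>] eh_nonneg[OF that] by (simp add: S_def)
  \<comment> \<open>The half-line is exhausted by \<open>[a i, b i]\<close>; the shifts \<open>m1\<close> and \<open>m2\<close> make all of these
    intervals contain every knot, as the orthogonality relation requires.\<close>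
  obtain m1 :: nat where m1: "inverse (real (Suc m1)) < \<rho> 1" using reals_Archimedean[OF \<rho>(2)] by blast
  obtain m2 :: nat where m2: "\<rho> n < real m2" using reals_Archimedean2 by blast
  define a b where "a i = inverse (real (Suc (i + m1)))" and "b i = real (i + m2)" for i
  have a: "decseq a" "a \<longlonglongrightarrow> 0" "0 < a i" "a i < \<rho> 1" for i
  proof -
    show "decseq a" unfolding a_def by (rule decseq_SucI) (simp add: field_simps)
    show "a \<longlonglongrightarrow> 0" unfolding a_def by (rule LIMSEQ_ignore_initial_segment[OF LIMSEQ_inverse_real_of_nat])
    show "0 < a i" by (simp add: a_def)
    have "a i \<le> inverse (real (Suc m1))" by (simp add: a_def field_simps)
    then show "a i < \<rho> 1" using m1 by simp
  qed
  have b: "incseq b" "filterlim b at_top sequentially" "\<rho> n < b i" for i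
  proof -
    show "incseq b" unfolding b_def by (rule incseq_SucI) simp
    show "filterlim b at_top sequentially"
      unfolding b_def by (rule filterlim_compose[OF filterlim_real_sequentially filterlim_add_const_nat_at_top])
    show "\<rho> n < b i" using m2 by (simp add: b_def)
  qed
  define M where "M = integral {0<..} (energy0 f)"
  define T where "T i = M - 2 * (Q (b i) - Q (a i) + w \<bullet> h (a i))" for i
  have at0: "filterlim a (at_right 0) sequentially"
    using a(2,3) by (intro tendsto_imp_filterlim_at_right) auto
  have wh: "((\<lambda>r. w \<bullet> h r) \<longlongrightarrow> 0) (at_right 0)" using boundary by (simp add: h_def)
  have "T \<longlonglongrightarrow> M - 2 * (0 - 0 + 0)"
    unfolding T_def
    by (intro tendsto_intros filterlim_compose[OF Qinf b(2)] filterlim_compose[OF Q0 at0] filterlim_compose[OF wh at0])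
  then have TM: "T \<longlonglongrightarrow> M" by simp
  have Sab: "(S has_integral integral {a i..b i} (energy0 f) - 2 * (Q (b i) - Q (a i) + w \<bullet> h (a i))) {a i..b i}" for i
  proof -
    have "((\<lambda>r. energy0 f r - 2 * X r) has_integral
        integral {a i..b i} (energy0 f) - 2 * (Q (b i) - Q (a i) + w \<bullet> h (a i))) {a i..b i}"
      by (intro has_integral_diff has_integral_mult_right X a b
          integrable_integral[OF Lambda0_energy_interval(1)[OF f a(3)]])
    then show ?thesis
      by (rule has_integral_eq[rotated]) (use split a(3)[of i] in auto)
  qed
  have Si: "S integrable_on {a i..b i}" for i using Sab by blast
  have ST: "integral {a i..b i} S \<le> T i" for i
    using integral_unique[OF Sab] Lambda0_energy_interval(2)[OF f a(3)] by (simp add: T_def M_def)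
  note Sint = integrable_by_exhaustion(1)[OF S_nonneg a(1-3) b(1,2) Si ST TM]
    and SM = integrable_by_exhaustion(2)[OF S_nonneg a(1-3) b(1,2) Si ST TM]
  have pos_meas: "{0::real<..} \<in> sets lebesgue" by (intro sets_completionI_sets) simp
  have e\<eta>: "energy0 \<eta> integrable_on {0<..}"
  proof (rule measurable_bounded_by_integrable_imp_integrable[OF _ Sint])
    have "continuous_on {0<..} (energy0 \<eta>)"
      unfolding energy0_def by (intro continuous_intros cont\<eta>) auto
    then show "energy0 \<eta> \<in> borel_measurable (lebesgue_on {0<..})"
      by (rule continuous_imp_measurable_on_sets_lebesgue[OF _ pos_meas])
    show "norm (energy0 \<eta> r) \<le> S r" if "r \<in> {0<..}" for r
      using that energy0_nonneg[of r \<eta>] eh_nonneg[of r] by (simp add: S_def)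
  qed (simp_all add: pos_meas)
  have eh_int: "eh integrable_on {0<..}"
    using integrable_diff[OF Sint e\<eta>] by (simp add: S_def)
  have sum: "integral {0<..} (energy0 \<eta>) + integral {0<..} eh \<le> M"
    using SM integral_add[OF e\<eta> eh_int] by (simp add: S_def[abs_def])
  have kc: "continuous_on {0<..} k"
    unfolding k_def by (intro continuous_intros Lambda0_C1(2)[OF f] cont\<eta>(1))
  \<comment> \<open>If \<open>h'\<close> vanished, \<open>h\<close> would be a constant that is zero at the knots.\<close>
  have "\<exists>r>0. k r \<noteq> 0"
  proof (rule ccontr)
    assume "\<not> (\<exists>r>0. k r \<noteq> 0)"
    then have "(h has_vector_derivative 0) (at r)" if "r \<in> {0<..}" for r
      using hk[of r] that by auto
    then obtain c where "\<And>r. r \<in> {0<..} \<Longrightarrow> h r = c"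
      using has_vector_derivative_zero_interval[of "{0<..}" h] by auto
    moreover have "h (\<rho> 1) = 0" using hzero n by simp
    ultimately have h0: "h r = 0" if "0 < r" for r using that \<rho>(2) by (metis greaterThan_iff)
    obtain r where "0 < r" "f r \<noteq> \<eta> r" using differ by blast
    with h0[of r] show False by (simp add: h_def)
  qed
  then obtain r0 where "0 < r0" "k r0 \<noteq> 0" by blast
  have minorant: "(1 / r) * (norm (k r))\<^sup>2 \<le> eh r" if "0 < r" for r
    using that by (simp add: eh_def)
  have "0 < integral {0<..} eh"
    by (rule integral_pos_of_continuous_minorant[OF eh_int minorant kc \<open>0 < r0\<close> \<open>k r0 \<noteq> 0\<close>])
  then have "integral {0<..} (energy0 \<eta>) < M" using sum by simp
  moreover have "norm0 \<eta> = sqrt (integral {0<..} (energy0 \<eta>))"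
  proof -
    have "energy0 \<eta> absolutely_integrable_on {0<..}"
      by (rule nonnegative_absolutely_integrable_1[OF e\<eta>]) (simp add: energy0_nonneg)
    then show ?thesis unfolding norm0_def using set_lebesgue_integral_eq_integral(2) by metis
  qed
  ultimately show ?thesis
    using Lambda0_energy(2)[OF f] by (simp add: M_def)
qed

text \<open>The two problems differ only in how the flux term \<open>w \<bullet> (f - \<sigma>) (0)\<close> is removed: by the condition at
zero for \<open>\<sigma>A\<close>, and by \<open>w = 0\<close>, the natural boundary condition, for the non-singular \<open>\<sigma>B\<close>.\<close>

theorem theorem3:
  fixes n :: nat and \<rho> :: "nat \<Rightarrow> real" and \<alpha> :: real and \<nu> :: "nat \<Rightarrow> real"
    and \<sigma>A \<sigma>B :: "real \<Rightarrow> complex"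
  assumes "1 \<le> n" and "strict_mono_on {1..n} \<rho>" and "0 < \<rho> 1"
    and "\<sigma>A \<in> S0 n \<rho>" and "\<forall>j\<in>{1..n}. \<sigma>A (\<rho> j) = of_real (\<nu> j)" and "\<sigma>A 0 = of_real \<alpha>"
    and "\<sigma>B \<in> S0 n \<rho>" and "nonsingular_spline \<rho> \<sigma>B"
    and "\<forall>j\<in>{1..n}. \<sigma>B (\<rho> j) = of_real (\<nu> j)"
  shows "(\<forall>f\<in>Lambda0. (\<forall>j\<in>{1..n}. f (\<rho> j) = of_real (\<nu> j)) \<longrightarrow>
            (f \<longlongrightarrow> of_real \<alpha>) (at_right 0) \<longrightarrow> (\<exists>r>0. f r \<noteq> \<sigma>A r) \<longrightarrow>
            norm0 \<sigma>A < norm0 f)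
       \<and> (\<forall>f\<in>Lambda0. (\<forall>j\<in>{1..n}. f (\<rho> j) = of_real (\<nu> j)) \<longrightarrow>
            (\<exists>r>0. f r \<noteq> \<sigma>B r) \<longrightarrow> norm0 \<sigma>B < norm0 f)"
proof (intro conjI ballI impI)
  fix f assume f: "f \<in> Lambda0" "\<forall>j\<in>{1..n}. f (\<rho> j) = of_real (\<nu> j)"
    "(f \<longlongrightarrow> of_real \<alpha>) (at_right 0)" "\<exists>r>0. f r \<noteq> \<sigma>A r"
  obtain w where w: "flux_on {0<..<\<rho> 1} \<sigma>A w"
    "((\<lambda>r. r *\<^sub>R nderiv 2 \<sigma>A r) \<longlongrightarrow> 0) (at_right 0)" "(nderiv 1 \<sigma>A \<longlongrightarrow> 0) (at_right 0)"
    using S0_near_zero[OF assms(4,3)] by metis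
  have "continuous (at_right 0) \<sigma>A" using assms(4) by (simp add: S0_def)
  then have "(\<sigma>A \<longlongrightarrow> of_real \<alpha>) (at_right 0)"
    using assms(6) by (simp add: continuous_within)
  then have "((\<lambda>r. w \<bullet> (f r - \<sigma>A r)) \<longlongrightarrow> w \<bullet> (of_real \<alpha> - of_real \<alpha>)) (at_right 0)"
    using f(3) by (intro tendsto_intros)
  then show "norm0 \<sigma>A < norm0 f"
    using assms(5) f(2)
    by (intro spline_minimises_energy[OF assms(4,1,2,3) w f(1) _ _ f(4)]) auto
next
  fix f assume f: "f \<in> Lambda0" "\<forall>j\<in>{1..n}. f (\<rho> j) = of_real (\<nu> j)" "\<exists>r>0. f r \<noteq> \<sigma>B r"
  obtain w where w: "flux_on {0<..<\<rho> 1} \<sigma>B w"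
    "((\<lambda>r. r *\<^sub>R nderiv 2 \<sigma>B r) \<longlongrightarrow> 0) (at_right 0)" "(nderiv 1 \<sigma>B \<longlongrightarrow> 0) (at_right 0)" "w = 0"
    using S0_near_zero[OF assms(7,3)] assms(8) by metis
  then show "norm0 \<sigma>B < norm0 f"
    using assms(9) f(2)
    by (intro spline_minimises_energy[OF assms(7,1,2,3) w(1-3) f(1) _ _ f(3)]) auto
qed

end
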